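(* Let $\alpha_0,\alpha_1,\alpha_2,\alpha_3$ be complex parameters with $\alpha_0+\alpha_1+2\alpha_2+\alpha_3=1$. Let $K\in\mathbb{C}(t)[x,y,z,w]$ and consider the polynomial Hamiltonian system with Hamiltonian $K$. Assume: (1) $\deg(K)=6$ with respect to $x,y,z,w$. (2) The system becomes again a polynomial Hamiltonian system in each of the coordinate systems $r_i=(x_i,y_i,z_i,w_i)$, $i=0,1,3$: $$\begin{aligned} r_0:\;&x_0=-((x-1)y-\alpha_0)y,\ y_0=\tfrac{1}{y},\ z_0=z,\ w_0=w, \\ r_1:\;&x_1=-(xy-\alpha_1)y,\ y_1=\tfrac{1}{y},\ z_1=z,\ w_1=w, \\ r_3:\;&x_3=x,\ y_3=y,\ z_3=-(zw-\alpha_3)w,\ w_3=\tfrac{1}{w}; \end{aligned}$$ that is, $K$ expressed in the coordinates $r_j$ is a polynomial in $x_j,y_j,z_j,w_j$ over $\mathbb{C}(t)$ for $j=0,1,3$. (3) In addition, the Hamiltonian system in the coordinates $r_1$ becomes again a polynomial Hamiltonian system in the coordinate system $r_2=(x_2,y_2,z_2,w_2)$: $$r_2:\;x_2=\tfrac{1}{x_1},\ y_2=-\left((y_1+w_1^2-t)x_1+\alpha_2 \right)x_1,\ z_2=z_1-2x_1w_1,\ w_2=w_1;$$ that is, writing $r_1(K)$ for $K$ expressed in the coordinates $r_1$, the function $r_1(K)+x_1$ expressed in the coordinates $r_2$ is a polynomial in $x_2,y_2,z_2,w_2$ over $\mathbb{C}(t)$. Then the system coincides with the Hamiltonian system with Hamiltonian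 $H$ given by $$\begin{aligned} t^2H =\;&-tx(x-1)y^2+\{x^2+((\alpha_0+\alpha_1)t-1)x-\alpha_1 t\}y+(\alpha_2+\alpha_3)x-(\alpha_0 t-1)\alpha_1\\ &-\frac{z^2w^4}{4}+\frac{\alpha_3}{2}zw^3+\frac{1}{4}(2tz^2-\alpha_3^2)w^2-\frac{1}{2}\{(\alpha_0+\alpha_1+2\alpha_2+2\alpha_3)t-1\}zw-\frac{t^2 z^2}{4}\\ &-xzw. \end{aligned}$$
   Context: The Hamiltonian system with Hamiltonian $K\in\mathbb{C}(t)[x,y,z,w]$ is $\frac{dx}{dt}=\frac{\partial K}{\partial y}$, $\frac{dy}{dt}=-\frac{\partial K}{\partial x}$, $\frac{dz}{dt}=\frac{\partial K}{\partial w}$, $\frac{dw}{dt}=-\frac{\partial K}{\partial z}$. Two Hamiltonian systems coincide if these differential equations are the same. Coefficients in $\mathbb{C}(t)$ are rational functions of $t$. *)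

theory Defs
  imports "HOL-Computational_Algebra.Computational_Algebra"
begin

text \<open>
  The field \<open>C(t)\<close>, the ring \<open>C(t)[x,y,z,w]\<close> (realised as \<open>C(t)[x][y][z][w]\<close>, so that
  \<open>w\<close> is the outermost and \<open>x\<close> the innermost variable), and its field of fractions
  \<open>C(t)(x,y,z,w)\<close>.
\<close>

type_synonym Ct = "complex poly fract"
type_synonym mpoly4 = "Ct poly poly poly poly"
type_synonym ratfun4 = "mpoly4 fract"
type_synonym coords = "ratfun4 \<times> ratfun4 \<times> ratfun4 \<times> ratfun4"

definition tvar :: Ct where
  "tvar = to_fract [:0, 1:]"

definition cnum :: "complex \<Rightarrow> Ct" where
  "cnum c = to_fract [:c:]"

definition const4 :: "Ct \<Rightarrow> mpoly4" where
  "const4 c = [:[:[:[:c:]:]:]:]"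

definition varx :: mpoly4 where "varx = [:[:[:[:0, 1:]:]:]:]"
definition vary :: mpoly4 where "vary = [:[:[:0, 1:]:]:]"
definition varz :: mpoly4 where "varz = [:[:0, 1:]:]"
definition varw :: mpoly4 where "varw = [:0, 1:]"

definition coeff4 :: "mpoly4 \<Rightarrow> nat \<Rightarrow> nat \<Rightarrow> nat \<Rightarrow> nat \<Rightarrow> Ct" where
  "coeff4 P i j k l = coeff (coeff (coeff (coeff P l) k) j) i"

definition total_degree :: "mpoly4 \<Rightarrow> nat" where
  "total_degree P = Max (insert 0 {i + j + k + l | i j k l. coeff4 P i j k l \<noteq> 0})"

lemma finite_support_coeff4: "finite {(i, j, k, l). coeff4 P i j k l \<noteq> 0}"
proof -
  define B where "B = (\<Union>l\<le>degree P. \<Union>k\<le>degree (coeff P l). \<Union>j\<le>degree (coeff (coeff P l) k).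
    \<Union>i\<le>degree (coeff (coeff (coeff P l) k) j). {(i, j, k, l)})"
  have "finite B"
    unfolding B_def by auto
  moreover have "{(i, j, k, l). coeff4 P i j k l \<noteq> 0} \<subseteq> B"
  proof (clarify, goal_cases)
    case (1 i j k l)
    then have "coeff (coeff (coeff P l) k) j \<noteq> 0" "coeff (coeff P l) k \<noteq> 0" "coeff P l \<noteq> 0"
      and "coeff (coeff (coeff (coeff P l) k) j) i \<noteq> 0"
      by (auto simp: coeff4_def)
    then show ?case
      unfolding B_def by (auto intro!: le_degree)
  qed
  ultimately show ?thesis
    by (rule rev_finite_subset)
qed

text \<open>This shows that the maximum in \<open>total_degree\<close> is taken over a finite set.\<close>

lemma finite_total_degree_set: "finite {i + j + k + l | i j k l. coeff4 P i j k l \<noteq> 0}"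
proof -
  have "{i + j + k + l | i j k l. coeff4 P i j k l \<noteq> 0}
      = (\<lambda>(i, j, k, l). i + j + k + l) ` {(i, j, k, l). coeff4 P i j k l \<noteq> 0}"
    by (auto simp: image_iff) metis
  then show ?thesis
    by (simp add: finite_support_coeff4)
qed

definition pd_x :: "mpoly4 \<Rightarrow> mpoly4" where "pd_x = map_poly (map_poly (map_poly pderiv))"
definition pd_y :: "mpoly4 \<Rightarrow> mpoly4" where "pd_y = map_poly (map_poly pderiv)"
definition pd_z :: "mpoly4 \<Rightarrow> mpoly4" where "pd_z = map_poly pderiv"
definition pd_w :: "mpoly4 \<Rightarrow> mpoly4" where "pd_w = pderiv"

text \<open>The right-hand sides for \<open>dx/dt, dy/dt, dz/dt, dw/dt\<close>.\<close>

definition hamiltonian_system :: "mpoly4 \<Rightarrow> mpoly4 \<times> mpoly4 \<times> mpoly4 \<times> mpoly4" where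
  "hamiltonian_system K = (pd_y K, - pd_x K, pd_w K, - pd_z K)"

definition const_rat :: "Ct \<Rightarrow> ratfun4" where
  "const_rat c = to_fract (const4 c)"

text \<open>The value \<open>P(a,b,c,d)\<close>, for a polynomial \<open>P\<close> and rational functions \<open>a,b,c,d\<close>.\<close>

definition subst4 :: "mpoly4 \<Rightarrow> coords \<Rightarrow> ratfun4" where
  "subst4 P = (\<lambda>(a, b, c, d).
     poly (map_poly (\<lambda>q. poly (map_poly (\<lambda>r. poly (map_poly (\<lambda>s.
       poly (map_poly const_rat s) a) r) b) q) c) P) d)"

text \<open>
  A coordinate system is a quadruple of elements of \<open>C(t)(x,y,z,w)\<close>. A function \<open>F\<close> expressed
  in these coordinates is a polynomial in them over \<open>C(t)\<close> iff it is the value of some polynomial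
  at this quadruple. Rewriting \<open>F\<close> in other coordinates does not change it as an element of
  \<open>C(t)(x,y,z,w)\<close>; so \<open>r_1(K)\<close> is represented by \<open>K\<close> itself.
\<close>

definition polynomial_in_coords :: "coords \<Rightarrow> ratfun4 \<Rightarrow> bool" where
  "polynomial_in_coords r F \<longleftrightarrow> (\<exists>P. F = subst4 P r)"

definition coords_xyzw :: coords where
  "coords_xyzw = (to_fract varx, to_fract vary, to_fract varz, to_fract varw)"

text \<open>
  Each transformation maps the old coordinates to the new ones; \<open>r2\<close> is to be
  applied to the coordinates \<open>r1\<close>.
\<close>

definition r0 :: "complex \<Rightarrow> coords \<Rightarrow> coords" where
  "r0 \<alpha>0 = (\<lambda>(x, y, z, w). (- ((x - 1) * y - const_rat (cnum \<alpha>0)) * y, 1 / y, z, w))"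

definition r1 :: "complex \<Rightarrow> coords \<Rightarrow> coords" where
  "r1 \<alpha>1 = (\<lambda>(x, y, z, w). (- (x * y - const_rat (cnum \<alpha>1)) * y, 1 / y, z, w))"

definition r2 :: "complex \<Rightarrow> coords \<Rightarrow> coords" where
  "r2 \<alpha>2 = (\<lambda>(x1, y1, z1, w1).
     (1 / x1, - ((y1 + w1^2 - const_rat tvar) * x1 + const_rat (cnum \<alpha>2)) * x1,
      z1 - 2 * x1 * w1, w1))"

definition r3 :: "complex \<Rightarrow> coords \<Rightarrow> coords" where
  "r3 \<alpha>3 = (\<lambda>(x, y, z, w). (x, y, - (z * w - const_rat (cnum \<alpha>3)) * w, 1 / w))"

definition ham_H :: "complex \<Rightarrow> complex \<Rightarrow> complex \<Rightarrow> complex \<Rightarrow> mpoly4" where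
  "ham_H \<alpha>0 \<alpha>1 \<alpha>2 \<alpha>3 =
    (let x = varx; y = vary; z = varz; w = varw; t = const4 tvar;
         a0 = const4 (cnum \<alpha>0); a1 = const4 (cnum \<alpha>1);
         a2 = const4 (cnum \<alpha>2); a3 = const4 (cnum \<alpha>3)
     in const4 (1 / tvar^2) *
       (- t * x * (x - 1) * y^2 + (x^2 + ((a0 + a1) * t - 1) * x - a1 * t) * y
        + (a2 + a3) * x - (a0 * t - 1) * a1
        - const4 (1/4) * z^2 * w^4 + const4 (1/2) * a3 * z * w^3
        + const4 (1/4) * (2 * t * z^2 - a3^2) * w^2
        - const4 (1/2) * ((a0 + a1 + 2 * a2 + 2 * a3) * t - 1) * z * w
        - const4 (1/4) * t^2 * z^2
        - x * z * w))"

end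

theory Submission
  imports Defs
begin

text \<open>
  Write \<open>F = C(t)\<close>. All four changes of coordinates have the same shape: a polynomial ring
  \<open>F[X,u]\<close> sits inside the Laurent polynomials \<open>F[s][u,1/u]\<close> by \<open>s = a - X u\<close>. With \<open>u = 1/y\<close> and
  \<open>s = x y\<close> this is \<open>r1\<close>; with \<open>s = (x - 1) y\<close> it is \<open>r0\<close>; with \<open>u = 1/w\<close> and \<open>s = z w\<close> it is \<open>r3\<close>; and
  \<open>r2\<close> is of this kind with \<open>u = 1/x\<^sub>1\<close>, \<open>s = (y\<^sub>1 + w^2 - t) x\<^sub>1\<close>, \<open>a = -\<alpha>2\<close>, once \<open>z\<^sub>1 - 2 x\<^sub>1 w\<close> is
  used in place of \<open>z\<^sub>1\<close>. If \<open>\<Sum> f\<^sub>m(s) u^(-m)\<close> lies in \<open>F[X,u]\<close>, then \<open>(s - a)^m\<close> divides \<open>f\<^sub>m\<close> for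
  every \<open>m > 0\<close> (\<open>blowup_dvd\<close>). So each regularity hypothesis is a list of divisibilities for the
  coefficient polynomials of \<open>K\<close>, and a low degree forces most of these polynomials to vanish.

  Since \<open>F\<close> is infinite, polynomials may be replaced by the functions that they define, and the
  hypotheses become identities between values of polynomials on \<open>F^4\<close> (\<open>regular_r0\<close> to \<open>regular_r2\<close>).

  The charts \<open>r0\<close> and \<open>r1\<close> and the degree bound 6 leave \<open>K = A y^2 + B y + D\<close> with \<open>x (x - 1)\<close> dividing \<open>A\<close> and
  with \<open>B(0)\<close> and \<open>B(1)\<close> determined by \<open>A\<close> (\<open>coeffs_xy\<close>). The chart \<open>r3\<close> restricts the monomials
  \<open>z^k w^l\<close> with \<open>l > k\<close> (\<open>coeffs_zw\<close>).

  For \<open>r2\<close>, fix \<open>w\<close> and put \<open>c = t - w^2\<close>. Near \<open>u = 0\<close> one has \<open>y \<rightarrow> 1/c\<close>, while \<open>x\<close> and \<open>z\<close> have simple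
  poles, with \<open>z + 2 w x / c^2\<close> less singular. If \<open>N \<ge> 2\<close> is the degree of \<open>K\<close> in \<open>x, z\<close> together, the leading form
  at \<open>y = 1/c\<close> must therefore be a multiple \<open>\<kappa>(w) (z + 2 w x / c^2)^N\<close> (\<open>lead_coeffs\<close>). The denominators
  force \<open>c^(2 N - 2)\<close> to divide \<open>\<kappa>\<close> when \<open>N \<ge> 3\<close>, and \<open>\<kappa>\<close> has degree at most \<open>6 - N\<close>; so \<open>\<kappa> = 0\<close>
  (\<open>lead_zero\<close>). This gives \<open>N \<le> 3\<close>, with one possible cubic term \<open>x^2 z (1 - c y)\<close>, which the next order in
  \<open>u\<close> excludes (\<open>cubic_coeff_zero\<close>).

  For \<open>N = 2\<close> the leading form is determined by one constant \<open>\<eta>\<close>, the coefficient of \<open>z^2 w^4\<close>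
  (\<open>quadratic_coeffs\<close>). The simple pole along \<open>u = 0\<close> is the last condition: its residue, a polynomial in
  \<open>s\<close>, must vanish at \<open>s = -\<alpha>2\<close> identically in \<open>w\<close> (\<open>linear_coeffs\<close>). Eliminating the coefficient of
  \<open>x\<close> between the powers \<open>w^0\<close> and \<open>w^4\<close> leaves \<open>4 \<eta> t^2 (\<alpha>0 + \<alpha>1 + 2 \<alpha>2 + \<alpha>3) = -1\<close>, where the right-hand side
  comes from the summand \<open>x\<^sub>1\<close> in the hypothesis on \<open>r2\<close>. As the parameters satisfy
  \<open>\<alpha>0 + \<alpha>1 + 2 \<alpha>2 + \<alpha>3 = 1\<close>, this fixes \<open>\<eta> = -1 / (4 t^2)\<close>, and the other powers of \<open>w\<close> fix the other
  coefficients. Only the constant term of \<open>K\<close> stays free, and it does not enter the differential equations.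
\<close>

section \<open>Values of rational functions at points\<close>

text \<open>
  Characteristic zero makes \<open>F = C(t)\<close> infinite, so that polynomials over \<open>F\<close> can be identified with the
  functions that they define.
\<close>

instance fract :: ("{idom,ring_char_0}") field_char_0
proof
  have "of_nat n = (to_fract (of_nat n) :: 'a fract)" for n
    by (induction n) simp_all
  then show "inj (of_nat :: nat \<Rightarrow> 'a fract)"
    by (intro injI) (simp only: to_fract_eq_iff of_nat_eq_iff)
qed

definition ev4 :: "mpoly4 \<Rightarrow> Ct \<Rightarrow> Ct \<Rightarrow> Ct \<Rightarrow> Ct \<Rightarrow> Ct" where
  "ev4 P x y z w = poly (poly (poly (poly P [:[:[:w:]:]:]) [:[:z:]:]) [:y:]) x"

lemma ev4_hom [simp]:
  "ev4 (P + Q) x y z w = ev4 P x y z w + ev4 Q x y z w"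
  "ev4 (P - Q) x y z w = ev4 P x y z w - ev4 Q x y z w"
  "ev4 (- P) x y z w = - ev4 P x y z w"
  "ev4 (P * Q) x y z w = ev4 P x y z w * ev4 Q x y z w"
  "ev4 (P ^ n) x y z w = ev4 P x y z w ^ n"
  "ev4 0 x y z w = 0" "ev4 1 x y z w = 1"
  "ev4 (const4 c) x y z w = c"
  "ev4 varx x y z w = x" "ev4 vary x y z w = y" "ev4 varz x y z w = z" "ev4 varw x y z w = w"
  by (simp_all add: ev4_def const4_def varx_def vary_def varz_def varw_def)

lemma ev4_numeral [simp]: "ev4 (numeral n) x y z w = numeral n"
  by (simp add: ev4_def)

definition support_le :: "nat \<Rightarrow> mpoly4 \<Rightarrow> bool" where
  "support_le n P \<longleftrightarrow> (\<forall>i j k l. coeff4 P i j k l \<noteq> 0 \<longrightarrow> i \<le> n \<and> j \<le> n \<and> k \<le> n \<and> l \<le> n)"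

lemma support_le_exists: "\<exists>n. support_le n P"
proof -
  have "finite ((\<lambda>(i, j, k, l). i + j + k + l) ` {(i, j, k, l). coeff4 P i j k l \<noteq> 0})"
    by (intro finite_imageI finite_support_coeff4)
  then obtain n where "\<And>m. m \<in> (\<lambda>(i, j, k, l). i + j + k + l) ` {(i, j, k, l). coeff4 P i j k l \<noteq> 0} \<Longrightarrow> m \<le> n"
    by (meson finite_nat_set_iff_bounded_le)
  then have "i + j + k + l \<le> n" if "coeff4 P i j k l \<noteq> 0" for i j k l
    using that by force
  then have "support_le n P"
    unfolding support_le_def by fastforce
  then show ?thesis ..
qed

lemma poly_map_poly_sum:
  fixes f :: "'a::zero \<Rightarrow> 'b::comm_ring_1"
  assumes "f 0 = 0" "\<And>i. i > n \<Longrightarrow> coeff p i = 0"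
  shows "poly (map_poly f p) x = (\<Sum>i\<le>n. f (coeff p i) * x ^ i)"
proof -
  have "map_poly f p = (\<Sum>i\<le>n. monom (f (coeff p i)) i)"
    using assms by (intro poly_eqI) (auto simp: coeff_map_poly coeff_sum not_le)
  then show ?thesis
    by (simp add: poly_sum poly_monom)
qed

lemma poly_sum_coeff:
  fixes p :: "'a::comm_ring_1 poly"
  assumes "\<And>i. i > n \<Longrightarrow> coeff p i = 0"
  shows "poly p x = (\<Sum>i\<le>n. coeff p i * x ^ i)"
  using poly_map_poly_sum[of "\<lambda>x. x" n p x] assms by simp

lemma support_le_coeff_eq_0:
  assumes "support_le n P"
  shows "l > n \<Longrightarrow> coeff P l = 0"
    and "k > n \<Longrightarrow> coeff (coeff P l) k = 0"
    and "j > n \<Longrightarrow> coeff (coeff (coeff P l) k) j = 0"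
    and "i > n \<Longrightarrow> coeff (coeff (coeff (coeff P l) k) j) i = 0"
proof -
  have *: "coeff (coeff (coeff (coeff P l) k) j) i = 0" if "\<not> (i \<le> n \<and> j \<le> n \<and> k \<le> n \<and> l \<le> n)" for i j k l
    using that assms unfolding support_le_def coeff4_def by blast
  show "l > n \<Longrightarrow> coeff P l = 0" "k > n \<Longrightarrow> coeff (coeff P l) k = 0"
    "j > n \<Longrightarrow> coeff (coeff (coeff P l) k) j = 0"
    "i > n \<Longrightarrow> coeff (coeff (coeff (coeff P l) k) j) i = 0"
    by (auto intro!: poly_eqI *)
qed

lemma ev4_eq_sum:
  assumes "support_le n P"
  shows "ev4 P x y z w = (\<Sum>l\<le>n. \<Sum>k\<le>n. \<Sum>j\<le>n. \<Sum>i\<le>n. coeff4 P i j k l * x ^ i * y ^ j * z ^ k * w ^ l)"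
  unfolding ev4_def coeff4_def
  by (simp add: poly_sum_coeff[OF support_le_coeff_eq_0(1)[OF assms]]
      poly_sum_coeff[OF support_le_coeff_eq_0(2)[OF assms]]
      poly_sum_coeff[OF support_le_coeff_eq_0(3)[OF assms]]
      poly_sum_coeff[OF support_le_coeff_eq_0(4)[OF assms]] poly_sum sum_distrib_right mult.assoc)

lemma const_rat_0 [simp]: "const_rat 0 = 0"
  by (simp add: const_rat_def const4_def)

lemma subst4_eq_sum:
  assumes "support_le n P"
  shows "subst4 P (a, b, c, d) = (\<Sum>l\<le>n. \<Sum>k\<le>n. \<Sum>j\<le>n. \<Sum>i\<le>n.
    const_rat (coeff4 P i j k l) * a ^ i * b ^ j * c ^ k * d ^ l)"
proof -
  note S = support_le_coeff_eq_0[OF assms]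
  show ?thesis
    unfolding subst4_def coeff4_def
    by (simp add: poly_map_poly_sum[OF _ S(1)] poly_map_poly_sum[OF _ S(2)] poly_map_poly_sum[OF _ S(3)]
        poly_map_poly_sum[OF _ S(4)] sum_distrib_right)
qed

text \<open>
  The value of a rational function \<open>f = A / B\<close> at a point where the denominator \<open>B\<close> does not vanish. It is a
  relation because \<open>f\<close> may have no value at the point, and because the representation \<open>A / B\<close> is not fixed.
\<close>

definition has_value :: "Ct \<times> Ct \<times> Ct \<times> Ct \<Rightarrow> ratfun4 \<Rightarrow> Ct \<Rightarrow> bool" where
  "has_value p f c \<longleftrightarrow> (case p of (x, y, z, w) \<Rightarrow>
     \<exists>A B. f * to_fract B = to_fract A \<and> ev4 B x y z w \<noteq> 0 \<and> ev4 A x y z w = c * ev4 B x y z w)"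

lemma has_value_unique:
  assumes "has_value p f c" "has_value p f d"
  shows "c = d"
proof -
  obtain x y z w where p: "p = (x, y, z, w)" by (cases p)
  obtain A B where AB: "f * to_fract B = to_fract A" "ev4 B x y z w \<noteq> 0" "ev4 A x y z w = c * ev4 B x y z w"
    using assms(1) by (auto simp: has_value_def p)
  obtain A' B' where AB': "f * to_fract B' = to_fract A'" "ev4 B' x y z w \<noteq> 0" "ev4 A' x y z w = d * ev4 B' x y z w"
    using assms(2) by (auto simp: has_value_def p)
  have "to_fract (A * B') = to_fract (A' * B)"
    using AB(1) AB'(1) by (simp flip: AB(1) AB'(1))
  then have "A * B' = A' * B" by (simp only: to_fract_eq_iff)
  then have "ev4 (A * B') x y z w = ev4 (A' * B) x y z w" by simp
  then show ?thesis using AB AB' by simp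
qed

lemma has_value_poly: "has_value (x, y, z, w) (to_fract P) (ev4 P x y z w)"
  unfolding has_value_def split by (rule exI[of _ P], rule exI[of _ 1]) simp

lemma has_value_const: "has_value p (const_rat c) c"
  by (cases p) (metis const_rat_def ev4_hom(8) has_value_poly)

lemma has_value_add:
  assumes "has_value p f c" "has_value p g d"
  shows "has_value p (f + g) (c + d)"
proof -
  obtain x y z w where p: "p = (x, y, z, w)" by (cases p)
  obtain A B where AB: "f * to_fract B = to_fract A" "ev4 B x y z w \<noteq> 0" "ev4 A x y z w = c * ev4 B x y z w"
    using assms(1) by (auto simp: has_value_def p)
  obtain A' B' where AB': "g * to_fract B' = to_fract A'" "ev4 B' x y z w \<noteq> 0" "ev4 A' x y z w = d * ev4 B' x y z w"
    using assms(2) by (auto simp: has_value_def p)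
  have "(f + g) * to_fract (B * B') = to_fract (A * B' + A' * B)"
    by (simp add: algebra_simps flip: AB(1) AB'(1))
  then show ?thesis
    using AB AB' unfolding has_value_def p split
    by - (rule exI[of _ "A * B' + A' * B"], rule exI[of _ "B * B'"], simp add: algebra_simps)
qed

lemma has_value_mult:
  assumes "has_value p f c" "has_value p g d"
  shows "has_value p (f * g) (c * d)"
proof -
  obtain x y z w where p: "p = (x, y, z, w)" by (cases p)
  obtain A B where AB: "f * to_fract B = to_fract A" "ev4 B x y z w \<noteq> 0" "ev4 A x y z w = c * ev4 B x y z w"
    using assms(1) by (auto simp: has_value_def p)
  obtain A' B' where AB': "g * to_fract B' = to_fract A'" "ev4 B' x y z w \<noteq> 0" "ev4 A' x y z w = d * ev4 B' x y z w"
    using assms(2) by (auto simp: has_value_def p)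
  have "(f * g) * to_fract (B * B') = to_fract (A * A')"
    by (simp add: algebra_simps flip: AB(1) AB'(1))
  then show ?thesis
    using AB AB' unfolding has_value_def p split
    by - (rule exI[of _ "A * A'"], rule exI[of _ "B * B'"], simp)
qed

lemma has_value_inverse:
  assumes "has_value p f c" "c \<noteq> 0"
  shows "has_value p (1 / f) (1 / c)"
proof -
  obtain x y z w where p: "p = (x, y, z, w)" by (cases p)
  obtain A B where AB: "f * to_fract B = to_fract A" "ev4 B x y z w \<noteq> 0" "ev4 A x y z w = c * ev4 B x y z w"
    using assms(1) by (auto simp: has_value_def p)
  have "A \<noteq> 0" using AB(2,3) assms(2) by auto
  then have "f \<noteq> 0" using AB(1) by auto
  then have "1 / f * to_fract A = to_fract B" by (simp flip: AB(1))
  then show ?thesis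
    using AB assms(2) unfolding has_value_def p split
    by - (rule exI[of _ B], rule exI[of _ A], simp)
qed

lemma has_value_uminus:
  assumes "has_value p f c"
  shows "has_value p (- f) (- c)"
proof -
  have "const_rat (- 1) = - 1"
    by (simp add: const_rat_def const4_def one_pCons flip: to_fract_1 to_fract_uminus)
  then show ?thesis
    using has_value_mult[OF has_value_const[of p "- 1"] assms] by simp
qed

lemma has_value_diff: "has_value p f c \<Longrightarrow> has_value p g d \<Longrightarrow> has_value p (f - g) (c - d)"
  using has_value_add[OF _ has_value_uminus] by fastforce

lemma has_value_one: "has_value p 1 1"
  using has_value_const[of p 1] by (simp add: const_rat_def const4_def flip: one_pCons)

lemma has_value_power: "has_value p f c \<Longrightarrow> has_value p (f ^ n) (c ^ n)"
  by (induction n) (simp_all add: has_value_mult has_value_one)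

lemma has_value_sum: "(\<And>i. i \<in> A \<Longrightarrow> has_value p (f i) (c i)) \<Longrightarrow> has_value p (sum f A) (sum c A)"
proof (induction A rule: infinite_finite_induct)
  case (insert i A)
  then show ?case by (simp add: has_value_add)
qed (use has_value_const[of p 0] in auto)

lemma has_value_two: "has_value p 2 2"
  using has_value_add[OF has_value_one has_value_one] by simp

lemmas has_value_intros = has_value_const has_value_add has_value_mult has_value_inverse
  has_value_uminus has_value_diff has_value_one has_value_power has_value_two

lemma has_value_subst4:
  assumes "has_value p f1 a" "has_value p f2 b" "has_value p f3 c" "has_value p f4 d"
  shows "has_value p (subst4 P (f1, f2, f3, f4)) (ev4 P a b c d)"
proof -
  obtain n where n: "support_le n P" using support_le_exists ..
  show ?thesis
    unfolding subst4_eq_sum[OF n] ev4_eq_sum[OF n]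
    by (intro has_value_sum has_value_intros assms)
qed

text \<open>
  An identity \<open>F = Q(f1, f2, f3, f4)\<close> of rational functions may be evaluated at every point where all the
  functions involved have values. This is the passage from the field of fractions to functions on \<open>F^4\<close>.
\<close>

lemma polynomial_in_coords_value:
  assumes "polynomial_in_coords (f1, f2, f3, f4) F"
  obtains Q where "\<And>p a b c d e. has_value p f1 a \<Longrightarrow> has_value p f2 b \<Longrightarrow> has_value p f3 c \<Longrightarrow>
    has_value p f4 d \<Longrightarrow> has_value p F e \<Longrightarrow> e = ev4 Q a b c d"
  using assms has_value_subst4 has_value_unique unfolding polynomial_in_coords_def by metis

lemma has_value_vars:
  "has_value (x, y, z, w) (to_fract varx) x" "has_value (x, y, z, w) (to_fract vary) y"
  "has_value (x, y, z, w) (to_fract varz) z" "has_value (x, y, z, w) (to_fract varw) w"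
  using has_value_poly[of x y z w varx] has_value_poly[of x y z w vary]
    has_value_poly[of x y z w varz] has_value_poly[of x y z w varw] by simp_all

lemma regular_r0:
  assumes "polynomial_in_coords (r0 \<alpha> coords_xyzw) (to_fract K)"
  obtains Q where "\<And>x y z w. y \<noteq> 0 \<Longrightarrow> ev4 K x y z w = ev4 Q (- ((x - 1) * y - cnum \<alpha>) * y) (1 / y) z w"
proof -
  show ?thesis
    using assms unfolding r0_def coords_xyzw_def split
    by (elim polynomial_in_coords_value) 
      (rule that, blast intro: has_value_intros has_value_vars has_value_poly)
qed

lemma regular_r1:
  assumes "polynomial_in_coords (r1 \<alpha> coords_xyzw) (to_fract K)"
  obtains Q where "\<And>x y z w. y \<noteq> 0 \<Longrightarrow> ev4 K x y z w = ev4 Q (- (x * y - cnum \<alpha>) * y) (1 / y) z w"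
proof -
  show ?thesis
    using assms unfolding r1_def coords_xyzw_def split
    by (elim polynomial_in_coords_value) 
      (rule that, blast intro: has_value_intros has_value_vars has_value_poly)
qed

lemma regular_r3:
  assumes "polynomial_in_coords (r3 \<alpha> coords_xyzw) (to_fract K)"
  obtains Q where "\<And>x y z w. w \<noteq> 0 \<Longrightarrow> ev4 K x y z w = ev4 Q x y (- (z * w - cnum \<alpha>) * w) (1 / w)"
proof -
  show ?thesis
    using assms unfolding r3_def coords_xyzw_def split
    by (elim polynomial_in_coords_value) 
      (rule that, blast intro: has_value_intros has_value_vars has_value_poly)
qed

lemma regular_r2:
  assumes "polynomial_in_coords (r2 \<alpha>2 (r1 \<alpha>1 coords_xyzw)) (to_fract K + fst (r1 \<alpha>1 coords_xyzw))"
  obtains Q where "\<And>x y z w X. y \<noteq> 0 \<Longrightarrow> X = - (x * y - cnum \<alpha>1) * y \<Longrightarrow> X \<noteq> 0 \<Longrightarrow>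
    ev4 K x y z w + X = ev4 Q (1 / X) (- ((1 / y + w^2 - tvar) * X + cnum \<alpha>2) * X) (z - 2 * X * w) w"
proof (rule polynomial_in_coords_value[OF assms[unfolded r1_def r2_def coords_xyzw_def split fst_conv]])
  fix Q
  assume Q: "\<And>p a b c d e.
    has_value p (1 / (- (to_fract varx * to_fract vary - const_rat (cnum \<alpha>1)) * to_fract vary)) a \<Longrightarrow>
    has_value p (- ((1 / to_fract vary + (to_fract varw)\<^sup>2 - const_rat tvar) *
      (- (to_fract varx * to_fract vary - const_rat (cnum \<alpha>1)) * to_fract vary) + const_rat (cnum \<alpha>2)) *
      (- (to_fract varx * to_fract vary - const_rat (cnum \<alpha>1)) * to_fract vary)) b \<Longrightarrow>
    has_value p (to_fract varz - 2 * (- (to_fract varx * to_fract vary - const_rat (cnum \<alpha>1)) * to_fract vary)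
      * to_fract varw) c \<Longrightarrow>
    has_value p (to_fract varw) d \<Longrightarrow>
    has_value p (to_fract K + - (to_fract varx * to_fract vary - const_rat (cnum \<alpha>1)) * to_fract vary) e \<Longrightarrow>
    e = ev4 Q a b c d"
  show ?thesis
  proof (rule that)
    fix x y z w X
    assume y: "y \<noteq> 0" and X: "X = - (x * y - cnum \<alpha>1) * y" "X \<noteq> 0"
    show "ev4 K x y z w + X = ev4 Q (1 / X) (- ((1 / y + w^2 - tvar) * X + cnum \<alpha>2) * X) (z - 2 * X * w) w"
      by (rule Q[of "(x, y, z, w)"]; (unfold X(1))?;
          intro has_value_intros has_value_vars has_value_poly y X(2)[unfolded X(1)])
  qed
qed

section \<open>Divisibility at the centre of a blow-up\<close>

text \<open>
  Polynomial functions of two variables, with the second variable as the outer one. Working with the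
  functions allows any polynomial of four arguments to be restricted to a surface without naming
  the resulting bivariate polynomial.
\<close>

definition polyfun2 :: "('a::comm_ring_1 \<Rightarrow> 'a \<Rightarrow> 'a) \<Rightarrow> bool" where
  "polyfun2 f \<longleftrightarrow> (\<exists>Q. \<forall>x u. f x u = poly (poly Q [:u:]) x)"

lemma polyfun2_const: "polyfun2 (\<lambda>x u. c)"
  unfolding polyfun2_def by (rule exI[of _ "[:[:c:]:]"]) simp

lemma polyfun2_fst: "polyfun2 (\<lambda>x u. x)"
  unfolding polyfun2_def by (rule exI[of _ "[:[:0, 1:]:]"]) simp

lemma polyfun2_snd: "polyfun2 (\<lambda>x u. u)"
  unfolding polyfun2_def by (rule exI[of _ "[:0, 1:]"]) simp

lemma polyfun2_add: "polyfun2 f \<Longrightarrow> polyfun2 g \<Longrightarrow> polyfun2 (\<lambda>x u. f x u + g x u)"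
  unfolding polyfun2_def by (metis poly_add)

lemma polyfun2_mult: "polyfun2 f \<Longrightarrow> polyfun2 g \<Longrightarrow> polyfun2 (\<lambda>x u. f x u * g x u)"
  unfolding polyfun2_def by (metis poly_mult)

lemma polyfun2_uminus: "polyfun2 f \<Longrightarrow> polyfun2 (\<lambda>x u. - f x u)"
  unfolding polyfun2_def by (metis poly_minus)

lemma polyfun2_diff: "polyfun2 f \<Longrightarrow> polyfun2 g \<Longrightarrow> polyfun2 (\<lambda>x u. f x u - g x u)"
  unfolding polyfun2_def by (metis poly_diff)

lemma polyfun2_power: "polyfun2 f \<Longrightarrow> polyfun2 (\<lambda>x u. f x u ^ n)"
  unfolding polyfun2_def by (metis poly_power)

lemma polyfun2_sum: "(\<And>i. i \<in> A \<Longrightarrow> polyfun2 (f i)) \<Longrightarrow> polyfun2 (\<lambda>x u. \<Sum>i\<in>A. f i x u)"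
  by (induction A rule: infinite_finite_induct) (simp_all add: polyfun2_const polyfun2_add)

lemmas polyfun2_intros = polyfun2_const polyfun2_fst polyfun2_snd polyfun2_add polyfun2_mult
  polyfun2_uminus polyfun2_diff polyfun2_power

lemma polyfun2_ev4:
  assumes "polyfun2 a" "polyfun2 b" "polyfun2 c" "polyfun2 d"
  shows "polyfun2 (\<lambda>x u. ev4 Q (a x u) (b x u) (c x u) (d x u))"
proof -
  obtain n where n: "support_le n Q" using support_le_exists ..
  show ?thesis
    unfolding ev4_eq_sum[OF n] by (intro polyfun2_sum polyfun2_intros assms)
qed

lemma poly_eqI_cofinite:
  fixes p q :: "'a::field_char_0 poly"
  assumes "finite {x. poly p x \<noteq> poly q x}"
  shows "p = q"
proof (rule ccontr)
  assume "p \<noteq> q"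
  then have "finite {x. poly (p - q) x = 0}"
    by (intro poly_roots_finite) simp
  with assms have "finite ({x. poly p x \<noteq> poly q x} \<union> {x. poly (p - q) x = 0})"
    by simp
  also have "\<dots> = UNIV" by auto
  finally show False using infinite_UNIV_char_0 by blast
qed

text \<open>
  Let \<open>G = \<Sum> g\<^sub>n(s) u^n\<close>. If the substitution \<open>s = a - x u\<close> makes \<open>G\<close> divisible by \<open>u^M\<close>, then \<open>g\<^sub>n\<close>
  vanishes to order \<open>M - n\<close> at \<open>a\<close>: in the Taylor expansion \<open>g\<^sub>n(a - x u) = \<Sum> h\<^sub>n\<^sub>k x^k u^k\<close> the monomials
  \<open>x^k u^(n + k)\<close> that arise from different pairs \<open>(n, k)\<close> are different, so no cancellation is possible and
  \<open>h\<^sub>n\<^sub>k = 0\<close> as soon as \<open>n + k < M\<close>. Finitely many exceptional \<open>u\<close> are admitted for every \<open>x\<close>, because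
  the charts are undefined there.
\<close>

lemma blowup_dvd:
  fixes G :: "'a::field_char_0 poly poly"
  assumes q: "polyfun2 q"
    and G: "\<And>x. finite {u. poly (poly G [:u:]) (a - x * u) \<noteq> u ^ M * q x u}"
    and n: "n < M"
  shows "[:- a, 1:] ^ (M - n) dvd coeff G n"
proof -
  obtain Q where Q: "q x u = poly (poly Q [:u:]) x" for x u
    using q unfolding polyfun2_def by blast
  \<comment> \<open>The Taylor expansion of \<open>g\<^sub>n\<close> at \<open>a\<close>, in powers of \<open>a - s\<close>.\<close>
  define h where "h n = pcompose (coeff G n) [:a, -1:]" for n
  have h_coeff: "coeff (h m) (r - m) = 0" if "r < M" "m \<le> r" for r m
  proof -
    define R where "R = (\<Sum>m\<le>r. monom (coeff (h m) (r - m)) (r - m))"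
    have "poly R x = 0" for x
    proof -
      \<comment> \<open>For fixed \<open>x\<close>, both sides of the hypothesis as polynomials in \<open>u\<close>.\<close>
      define P where "P = (\<Sum>m\<le>max r (degree G). pcompose (h m) [:0, x:] * monom 1 m)"
      define QX where "QX = map_poly (\<lambda>p. poly p x) Q"
      have QX: "poly QX u = q x u" for u
      proof -
        have "poly QX u = (\<Sum>i\<le>degree Q. poly (coeff Q i) x * u ^ i)"
          unfolding QX_def by (rule poly_map_poly_sum) (auto simp: coeff_eq_0)
        also have "\<dots> = q x u"
          unfolding Q by (subst (2) poly_altdef) (simp add: poly_sum)
        finally show ?thesis .
      qed
      have P: "poly P u = poly (poly G [:u:]) (a - x * u)" for u
      proof -
        have "poly G [:u:] = (\<Sum>m\<le>max r (degree G). coeff G m * [:u:] ^ m)"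
          by (rule poly_sum_coeff) (simp add: coeff_eq_0)
        then show ?thesis
          by (simp add: P_def h_def poly_sum poly_pcompose poly_monom mult.commute)
      qed
      have "P = monom 1 M * QX"
        using G[of x] by (intro poly_eqI_cofinite) (simp add: P QX poly_monom)
      then have "coeff P r = 0"
        using \<open>r < M\<close> by (simp add: coeff_monom_mult)
      moreover have "coeff P r = (\<Sum>m\<le>r. coeff (h m) (r - m) * x ^ (r - m))"
        unfolding P_def coeff_sum
        by (intro sum.mono_neutral_cong_right)
          (auto simp: coeff_monom_mult coeff_pcompose_linear mult.commute)
      ultimately show ?thesis
        by (simp add: R_def poly_sum poly_monom)
    qed
    then have "R = 0"
      by (intro poly_eqI_cofinite) simp
    moreover have "coeff R (r - m) = coeff (h m) (r - m)"
    proof -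
      have "coeff R (r - m) = (\<Sum>k\<le>r. if k = m then coeff (h m) (r - m) else 0)"
        unfolding R_def coeff_sum using \<open>m \<le> r\<close> by (intro sum.cong) auto
      then show ?thesis using \<open>m \<le> r\<close> by simp
    qed
    ultimately show ?thesis by simp
  qed
  have "monom 1 (M - n) dvd h n"
    unfolding monom_1_dvd_iff'
  proof (intro allI impI)
    fix k assume "k < M - n"
    then show "coeff (h n) k = 0"
      using h_coeff[of "n + k" n] by simp
  qed
  then obtain r where r: "h n = monom 1 (M - n) * r" ..
  have "poly (coeff G n) y = poly ((- [:- a, 1:]) ^ (M - n) * pcompose r [:a, -1:]) y" for y
  proof -
    have "poly (coeff G n) y = poly (h n) (a - y)"
      by (simp add: h_def poly_pcompose)
    then show ?thesis
      by (simp add: r poly_pcompose poly_monom)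
  qed
  then have "coeff G n = (- [:- a, 1:]) ^ (M - n) * pcompose r [:a, -1:]"
    by (intro poly_eqI_cofinite) simp
  then show ?thesis
    unfolding power_minus[of "[:- a, 1:]"] by (auto intro: dvd_mult dvd_mult2)
qed

text \<open>
  In the chart \<open>x\<^sub>1 = -(x y - a) y\<close>, \<open>y\<^sub>1 = 1/y\<close> the monomials of a polynomial are grouped by
  \<open>m = j - i\<close>: the sum of all \<open>g\<^sub>i\<^sub>j x^i y^j\<close> with \<open>j - i = m\<close> is \<open>f\<^sub>m(x y) y^m\<close>, and \<open>x y = a - x\<^sub>1 y\<^sub>1\<close>.
\<close>

lemma bivariate_regular_dvd:
  fixes g :: "nat \<Rightarrow> nat \<Rightarrow> 'a::field_char_0"
  assumes q: "polyfun2 q"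
    and g: "\<And>x y. y \<noteq> 0 \<Longrightarrow> (\<Sum>j\<le>d. \<Sum>i\<le>d. g i j * x ^ i * y ^ j) = q (- (x * y - a) * y) (1 / y)"
    and m: "0 < m" "m \<le> d"
  shows "[:- a, 1:] ^ m dvd (\<Sum>i\<le>d - m. monom (g i (i + m)) i)"
proof -
  define G where "G = (\<Sum>j\<le>d. \<Sum>i\<le>d. monom (monom (g i j) i) (d + i - j))"
  have G: "poly (poly G [:u:]) (a - x * u) = u ^ d * q x u" if "u \<noteq> 0" for x u
  proof -
    have "poly (poly G [:u:]) (a - x * u) = (\<Sum>j\<le>d. \<Sum>i\<le>d. g i j * (a - x * u) ^ i * u ^ (d + i - j))"
      by (simp add: G_def poly_sum poly_monom)
    also have "\<dots> = u ^ d * (\<Sum>j\<le>d. \<Sum>i\<le>d. g i j * (u * (a - x * u)) ^ i * (1 / u) ^ j)"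
      unfolding sum_distrib_left
    proof (intro sum.cong refl)
      fix j i assume "j \<in> {..d}"
      then have "u ^ (d + i - j) = u ^ d * u ^ i * (1 / u) ^ j"
        using \<open>u \<noteq> 0\<close> by (simp add: power_diff power_add power_divide)
      then show "g i j * (a - x * u) ^ i * u ^ (d + i - j) = u ^ d * (g i j * (u * (a - x * u)) ^ i * (1 / u) ^ j)"
        by (simp add: power_mult_distrib)
    qed
    also have "\<dots> = u ^ d * q x u"
      using g[of "1 / u" "u * (a - x * u)"] \<open>u \<noteq> 0\<close> by simp
    finally show ?thesis .
  qed
  have "[:- a, 1:] ^ (d - (d - m)) dvd coeff G (d - m)"
  proof (rule blowup_dvd[OF q])
    show "finite {u. poly (poly G [:u:]) (a - x * u) \<noteq> u ^ d * q x u}" for x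
      by (rule finite_subset[of _ "{0}"]) (use G in auto)
  qed (use m in simp)
  moreover have "coeff G (d - m) = (\<Sum>i\<le>d - m. monom (g i (i + m)) i)"
  proof -
    have "coeff G (d - m) = (\<Sum>i\<le>d. \<Sum>j\<le>d. if d + i - j = d - m then monom (g i j) i else 0)"
      unfolding G_def coeff_sum by (subst sum.swap) simp
    also have "\<dots> = (\<Sum>i\<le>d. if i \<le> d - m then monom (g i (i + m)) i else 0)"
    proof (intro sum.cong refl)
      fix i assume "i \<in> {..d}"
      have "(\<Sum>j\<le>d. if d + i - j = d - m then monom (g i j) i else 0) =
          (\<Sum>j\<le>d. if j = i + m then monom (g i j) i else 0)"
        by (intro sum.cong refl if_cong) (use m in auto)
      then show "(\<Sum>j\<le>d. if d + i - j = d - m then monom (g i j) i else 0) =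
          (if i \<le> d - m then monom (g i (i + m)) i else 0)"
        using m by auto
    qed
    also have "\<dots> = (\<Sum>i\<le>d - m. monom (g i (i + m)) i)"
      by (intro sum.mono_neutral_cong_right) auto
    finally show ?thesis .
  qed
  ultimately show ?thesis using m by simp
qed

text \<open>
  In total degree 6 the polynomial \<open>f\<^sub>m\<close> of the preceding lemma has degree at most \<open>(6 - m) / 2\<close>. This is
  less than \<open>m\<close> for \<open>m \<ge> 3\<close>, equal to \<open>m\<close> for \<open>m = 2\<close>, so that \<open>f\<^sub>2\<close> is a multiple of \<open>(s - a)^2\<close>, and for
  \<open>m = 1\<close> there remains the equation \<open>f\<^sub>1(a) = 0\<close>.
\<close>

lemma bivariate_regular_coeffs:
  fixes g :: "nat \<Rightarrow> nat \<Rightarrow> 'a::field_char_0"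
  assumes q: "polyfun2 q"
    and g: "\<And>x y. y \<noteq> 0 \<Longrightarrow> (\<Sum>j\<le>6. \<Sum>i\<le>6. g i j * x ^ i * y ^ j) = q (- (x * y - a) * y) (1 / y)"
    and deg: "\<And>i j. i + j > 6 \<Longrightarrow> g i j = 0"
  shows "\<And>i m. m \<ge> 3 \<Longrightarrow> g i (i + m) = 0"
    and "g 0 2 = a ^ 2 * g 2 4" "g 1 3 = - 2 * a * g 2 4"
    and "g 0 1 = - a * g 1 2 - a ^ 2 * g 2 3"
proof -
  define f where "f m = (\<Sum>i\<le>6 - m. monom (g i (i + m)) i)" for m
  have f: "coeff (f m) i = g i (i + m)" for m i
  proof -
    have "coeff (f m) i = (\<Sum>k\<le>6 - m. if k = i then g i (i + m) else 0)"
      unfolding f_def coeff_sum by (intro sum.cong) auto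
    also have "\<dots> = g i (i + m)" using deg[of i "i + m"] by auto
    finally show ?thesis .
  qed
  have dvd: "[:- a, 1:] ^ m dvd f m" if "0 < m" "m \<le> 6" for m
    unfolding f_def using bivariate_regular_dvd[OF q g that] .
  have zero: "g i (i + m) = 0" if "m \<ge> 3" for i m
  proof (cases "m \<le> 6")
    case True
    have "f m = 0"
    proof (rule ccontr)
      assume "f m \<noteq> 0"
      have "degree ([:- a, 1:] ^ m) \<le> degree (f m)"
        using dvd that True \<open>f m \<noteq> 0\<close> by (intro dvd_imp_degree_le) auto
      moreover have "degree (f m) \<le> 1"
        using that deg by (intro degree_le) (auto simp: f)
      ultimately show False using that by (simp add: degree_linear_power)
    qed
    then show ?thesis using f[of m i] by simp
  qed (use deg in simp)
  show "\<And>i m. m \<ge> 3 \<Longrightarrow> g i (i + m) = 0" by (fact zero)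
  obtain r where r: "f 2 = [:- a, 1:] ^ 2 * r" using dvd[of 2] by (auto elim: dvdE)
  have "degree r = 0"
  proof (cases "r = 0")
    case False
    have "degree (f 2) \<le> 2"
      using deg by (intro degree_le) (auto simp: f)
    then show ?thesis using False by (simp add: r degree_mult_eq degree_linear_power)
  qed simp
  then obtain b where "r = [:b:]" using degree_eq_zeroE by blast
  then have "f 2 = [:a ^ 2 * b, - 2 * a * b, b:]"
    by (simp add: r power2_eq_square algebra_simps)
  then have "g 0 2 = a ^ 2 * b" "g 1 3 = - 2 * a * b" "g 2 4 = b"
    using f[of 2 0] f[of 2 1] f[of 2 2] by (simp_all add: numeral_eq_Suc)
  then show "g 0 2 = a ^ 2 * g 2 4" "g 1 3 = - 2 * a * g 2 4" by simp_all
  have "poly (f 1) a = 0"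
    using dvd[of 1] by (simp add: poly_eq_0_iff_dvd)
  moreover have "poly (f 1) a = g 0 1 + g 1 2 * a + g 2 3 * a ^ 2"
    by (subst poly_sum_coeff[of 2]) (auto simp: f deg numeral_eq_Suc)
  ultimately show "g 0 1 = - a * g 1 2 - a ^ 2 * g 2 3"
    by algebra
qed

section \<open>Regularity at two points of a line\<close>

text \<open>
  Regularity in the charts over \<open>x = 0\<close> and \<open>x = 1\<close>, applied to \<open>g\<close> and to its expansion \<open>h\<close> in powers of
  \<open>x - 1\<close>. Over \<open>x = 0\<close> the coefficient of \<open>y^4\<close> is a multiple of \<open>x^2\<close>, over \<open>x = 1\<close> it is a multiple
  of \<open>(x - 1)^2\<close>, and the degree bound leaves no room for both; the coefficient of \<open>y^3\<close> dies in the same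
  way. What is left is quadratic in \<open>y\<close>: its leading coefficient \<open>A\<close> vanishes at 0 and 1, and the equations
  for \<open>m = 1\<close> give \<open>B(0) = - a1 A'(0)\<close> and \<open>B(1) = - a0 A'(1)\<close> for the next coefficient \<open>B\<close>.
\<close>

lemma bivariate_two_points:
  fixes g :: "nat \<Rightarrow> nat \<Rightarrow> 'a::field_char_0"
  assumes q0: "polyfun2 q0" and q1: "polyfun2 q1"
    and g0: "\<And>x y. y \<noteq> 0 \<Longrightarrow> (\<Sum>j\<le>6. \<Sum>i\<le>6. g i j * x ^ i * y ^ j) = q0 (- ((x - 1) * y - a0) * y) (1 / y)"
    and g1: "\<And>x y. y \<noteq> 0 \<Longrightarrow> (\<Sum>j\<le>6. \<Sum>i\<le>6. g i j * x ^ i * y ^ j) = q1 (- (x * y - a1) * y) (1 / y)"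
    and deg: "\<And>i j. i + j > 6 \<Longrightarrow> g i j = 0"
  shows "\<And>i j. j \<ge> 3 \<Longrightarrow> g i j = 0"
    and "g 0 2 = 0" "g 0 1 = - a1 * g 1 2"
    and "(\<Sum>i\<le>6. g i 2) = 0" "(\<Sum>i\<le>6. g i 1) = - a0 * (\<Sum>i\<le>6. of_nat i * g i 2)"
proof -
  \<comment> \<open>The coefficients with respect to \<open>x - 1\<close>.\<close>
  define h where "h k j = (\<Sum>i\<le>6. of_nat (i choose k) * g i j)" for k j
  have h_deg: "h k j = 0" if "k + j > 6" for k j
    unfolding h_def
  proof (intro sum.neutral ballI)
    fix i show "of_nat (i choose k) * g i j = 0"
      using deg[of i j] that by (cases "i < k") (auto simp: binomial_eq_0)
  qed
  have h_sum: "(\<Sum>j\<le>6. \<Sum>k\<le>6. h k j * x ^ k * y ^ j) = (\<Sum>j\<le>6. \<Sum>i\<le>6. g i j * (x + 1) ^ i * y ^ j)" for x y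
  proof (rule sum.cong[OF refl])
    fix j :: nat
    have "(x + 1) ^ i = (\<Sum>k\<le>6. of_nat (i choose k) * x ^ k)" if "i \<le> 6" for i
      unfolding binomial_ring using that
      by (intro sum.mono_neutral_cong_left) (auto simp: binomial_eq_0)
    then have "(\<Sum>i\<le>6. g i j * (x + 1) ^ i * y ^ j) = (\<Sum>i\<le>6. \<Sum>k\<le>6. of_nat (i choose k) * g i j * x ^ k * y ^ j)"
      by (intro sum.cong refl) (simp add: sum_distrib_left sum_distrib_right mult_ac)
    then show "(\<Sum>k\<le>6. h k j * x ^ k * y ^ j) = (\<Sum>i\<le>6. g i j * (x + 1) ^ i * y ^ j)"
      unfolding h_def by (subst (asm) sum.swap) (simp add: sum_distrib_right)
  qed
  have h0: "(\<Sum>j\<le>6. \<Sum>k\<le>6. h k j * x ^ k * y ^ j) = q0 (- (x * y - a0) * y) (1 / y)" if "y \<noteq> 0" for x y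
    using g0[OF that, of "x + 1"] by (simp add: h_sum)
  note A = bivariate_regular_coeffs[OF q1 g1 deg]
  note B = bivariate_regular_coeffs[OF q0 h0 h_deg]
  have low: "g 0 3 = 0" "g 0 4 = 0" "g 1 4 = 0" "g 0 5 = 0" "g 1 5 = 0" "g 0 6 = 0"
    using A(1)[of 3 0] A(1)[of 4 0] A(1)[of 3 1] A(1)[of 5 0] A(1)[of 4 1] A(1)[of 6 0] by simp_all
  have "h 0 4 = g 0 4 + g 1 4 + g 2 4" "h 2 4 = g 2 4"
    "h 0 3 = g 0 3 + g 1 3 + g 2 3 + g 3 3" "h 1 3 = g 1 3 + 2 * g 2 3 + 3 * g 3 3"
    "h 2 3 = g 2 3 + 3 * g 3 3"
    unfolding h_def by (simp_all add: deg atMost_nat_numeral numeral_eq_Suc)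
  moreover have "h 0 4 = 0" "h 0 3 = 0" "h 1 3 = - 2 * a0 * h 2 4" "h 0 2 = a0 ^ 2 * h 2 4"
    "h 0 1 = - a0 * h 1 2 - a0 ^ 2 * h 2 3"
    using B(1)[of 4 0] B(1)[of 3 0] B(2-4) by simp_all
  ultimately have z: "g 2 4 = 0" "g 1 3 = 0" "g 0 2 = 0" "g 2 3 = 0" "g 3 3 = 0" "h 0 2 = 0"
    "h 0 1 = - a0 * h 1 2"
    using low A(2,3) by (simp_all; algebra)+
  show "g i j = 0" if "j \<ge> 3" for i j
  proof (cases "i + j > 6")
    case False
    then have "j = 3 \<and> i \<le> 3 \<or> j = 4 \<and> i \<le> 2 \<or> j \<ge> i + 3" using that by arith
    then consider "j = 3" "i \<le> 3" | "j = 4" "i \<le> 2" | "j \<ge> i + 3" by blast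
    then show ?thesis
    proof cases
      case 1
      then have "i = 0 \<or> i = 1 \<or> i = 2 \<or> i = 3" by auto
      then show ?thesis using 1 low z by auto
    next
      case 2
      then have "i = 0 \<or> i = 1 \<or> i = 2" by auto
      then show ?thesis using 2 low z by auto
    next
      case 3
      then show ?thesis using A(1)[of "j - i" i] by simp
    qed
  qed (use deg in simp)
  show "g 0 2 = 0" by fact
  show "g 0 1 = - a1 * g 1 2" using A(4) z by simp
  show "(\<Sum>i\<le>6. g i 2) = 0" using z(6) by (simp add: h_def)
  show "(\<Sum>i\<le>6. g i 1) = - a0 * (\<Sum>i\<le>6. of_nat i * g i 2)" using z(7) by (simp add: h_def)
qed

section \<open>Coefficients of polynomial identities\<close>

lemma coeffs_zero_if_function_zero:
  fixes c :: "nat \<Rightarrow> nat \<Rightarrow> 'a::field_char_0"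
  assumes "\<And>x y. (\<Sum>i\<le>n. \<Sum>j\<le>n. c i j * x ^ i * y ^ j) = 0" "i \<le> n" "j \<le> n"
  shows "c i j = 0"
proof -
  have univ: "d i = 0" if "\<And>x. (\<Sum>i\<le>n. d i * x ^ i) = 0" "i \<le> n" for d :: "nat \<Rightarrow> 'a" and i
  proof -
    have "(\<Sum>i\<le>n. monom (d i) i) = 0"
      using that(1) by (intro poly_eqI_cofinite) (simp add: poly_sum poly_monom)
    then have "coeff (\<Sum>i\<le>n. monom (d i) i) i = 0" by simp
    then show ?thesis using that(2) by (simp add: coeff_sum)
  qed
  have "(\<Sum>j\<le>n. c i j * y ^ j) = 0" for y
    by (rule univ[where d = "\<lambda>i. \<Sum>j\<le>n. c i j * y ^ j"])
      (use assms in \<open>simp_all add: sum_distrib_left sum_distrib_right mult_ac\<close>)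
  then show ?thesis
    using univ[of "c i" j] assms(3) by blast
qed

text \<open>
  A polynomial of degree at most \<open>n\<close> that is divisible by \<open>s^n\<close> is a multiple of \<open>s^n = (b - (b - s))^n\<close>, so
  its coefficients with respect to \<open>b - s\<close> are those of the binomial theorem.
\<close>

lemma binomial_coeffs_if_dvd:
  fixes p :: "'a::field_char_0 poly"
  assumes dvd: "[:0, 1:] ^ n dvd p" and p: "\<And>s. poly p s = (\<Sum>k\<le>n. \<beta> k * (b - s) ^ k)"
    and k: "k \<le> n"
  shows "\<beta> k = \<beta> n * of_nat (n choose k) * (- b) ^ (n - k)"
proof -
  obtain r where r: "p = [:0, 1:] ^ n * r" using dvd ..
  define P where "P = (\<Sum>k\<le>n. monom (\<beta> k) k)"
  have P: "P = [:b, -1:] ^ n * pcompose r [:b, -1:]"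
  proof (intro poly_eqI_cofinite)
    have "poly P s = poly ([:b, -1:] ^ n * pcompose r [:b, -1:]) s" for s
      using p[of "b - s"] by (simp add: P_def poly_sum poly_monom r poly_pcompose)
    then show "finite {s. poly P s \<noteq> poly ([:b, -1:] ^ n * pcompose r [:b, -1:]) s}" by simp
  qed
  have coeff_P: "coeff P k = \<beta> k" if "k \<le> n" for k
    using that by (simp add: P_def coeff_sum)
  have "degree P \<le> n"
    unfolding P_def by (intro degree_sum_le) (auto intro: order_trans[OF degree_monom_le])
  obtain e where e: "P = smult e ([:b, -1:] ^ n)"
  proof (cases "P = 0")
    case False
    then have "degree (pcompose r [:b, -1:]) = 0"
      using \<open>degree P \<le> n\<close> unfolding P by (subst (asm) degree_mult_eq) (auto simp: degree_power_eq)
    then obtain e where "pcompose r [:b, -1:] = [:e:]" using degree_eq_zeroE by blast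
    then show ?thesis using P that by simp
  qed (use that[of 0] in simp)
  have *: "\<beta> k = e * (of_nat (n choose k) * (- 1) ^ k * b ^ (n - k))" if "k \<le> n" for k
    using that by (simp flip: coeff_P add: e coeff_linear_poly_power)
  have "(- 1 :: 'a) ^ n * (- 1) ^ (n - k) = (- 1) ^ k"
    using k by (simp flip: power_add) (simp add: minus_one_power_iff)
  then show ?thesis
    using *[OF k] *[of n] unfolding power_minus[of b] by simp
qed

lemma sum_rotate: "(\<Sum>l\<in>A. \<Sum>k\<in>B. \<Sum>j\<in>D. f l k j) = (\<Sum>j\<in>D. \<Sum>l\<in>A. \<Sum>k\<in>B. f l k j)"
  by (subst sum.swap[of _ D B], subst sum.swap[of _ D A]) (rule refl)

lemma sum_upto_6: "(\<Sum>i\<le>6. f i) = f 0 + f 1 + f 2 + f 3 + f 4 + f 5 + f (6::nat)"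
  by (simp add: eval_nat_numeral add.assoc)

lemma sum_upto_2: "(\<Sum>i\<le>2. f i) = f 0 + f 1 + f (2::nat)"
  by (simp add: eval_nat_numeral)

lemma monom_list:
  "monom b 1 = [:0, b:]" "monom b 2 = [:0, 0, b:]" "monom b 3 = [:0, 0, 0, b:]" "monom b 4 = [:0, 0, 0, 0, b:]"
  by (simp_all add: numeral_eq_Suc monom_Suc monom_0)

section \<open>Regular Hamiltonians\<close>

text \<open>
  The hypotheses on \<open>K\<close> in terms of values at points, for arbitrary parameters in \<open>F\<close>. The polynomials
  \<open>Q0\<close> to \<open>Q3\<close> express \<open>K\<close>, or \<open>K + X\<close> in the case of \<open>Q2\<close>, in the four charts; \<open>X\<close> is the
  coordinate \<open>x\<^sub>1\<close>.
\<close>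

locale regular_hamiltonian =
  fixes K :: mpoly4 and a0 a1 a2 a3 t :: Ct and Q0 Q1 Q2 Q3 :: mpoly4
  assumes parameters: "a0 + a1 + 2 * a2 + a3 = 1"
    and t_nonzero: "t \<noteq> 0"
    and beyond_degree: "i + j + k + l > 6 \<Longrightarrow> coeff4 K i j k l = 0"
    and regular0: "y \<noteq> 0 \<Longrightarrow> ev4 K x y z w = ev4 Q0 (- ((x - 1) * y - a0) * y) (1 / y) z w"
    and regular1: "y \<noteq> 0 \<Longrightarrow> ev4 K x y z w = ev4 Q1 (- (x * y - a1) * y) (1 / y) z w"
    and regular3: "w \<noteq> 0 \<Longrightarrow> ev4 K x y z w = ev4 Q3 x y (- (z * w - a3) * w) (1 / w)"
    and regular2: "y \<noteq> 0 \<Longrightarrow> X = - (x * y - a1) * y \<Longrightarrow> X \<noteq> 0 \<Longrightarrow>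
      ev4 K x y z w + X = ev4 Q2 (1 / X) (- ((1 / y + w ^ 2 - t) * X + a2) * X) (z - 2 * X * w) w"
begin

abbreviation C :: "nat \<Rightarrow> nat \<Rightarrow> nat \<Rightarrow> nat \<Rightarrow> Ct" where "C \<equiv> coeff4 K"

lemma support: "support_le 6 K"
proof -
  have "i + j + k + l \<le> 6" if "C i j k l \<noteq> 0" for i j k l
    using that beyond_degree[of i j k l] by linarith
  then show ?thesis unfolding support_le_def by fastforce
qed

lemmas K_sum = ev4_eq_sum[OF support]

lemma K_sum_xy: "ev4 K x y z w = (\<Sum>j\<le>6. \<Sum>i\<le>6. (\<Sum>l\<le>6. \<Sum>k\<le>6. C i j k l * w ^ l * z ^ k) * x ^ i * y ^ j)"
proof -
  have "ev4 K x y z w = (\<Sum>j\<le>6. \<Sum>i\<le>6. \<Sum>l\<le>6. \<Sum>k\<le>6. C i j k l * x ^ i * y ^ j * z ^ k * w ^ l)"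
    unfolding K_sum by (subst sum_rotate, rule sum.cong[OF refl], subst sum_rotate) (rule refl)
  then show ?thesis
    by (simp add: sum_distrib_left sum_distrib_right mult_ac)
qed

lemma K_sum_zw: "ev4 K x y z w = (\<Sum>l\<le>6. \<Sum>k\<le>6. (\<Sum>j\<le>6. \<Sum>i\<le>6. C i j k l * y ^ j * x ^ i) * z ^ k * w ^ l)"
  unfolding K_sum by (simp add: sum_distrib_left sum_distrib_right mult_ac)

text \<open>
  \<open>bivariate_two_points\<close> applies for each fixed \<open>(z, w)\<close>. Its conclusions are linear in the
  coefficients, hence hold for the coefficient of each monomial \<open>z^k w^l\<close>.
\<close>

lemma coeffs_xy:
  shows "\<And>i j k l. j \<ge> 3 \<Longrightarrow> C i j k l = 0"
    and "\<And>k l. C 0 2 k l = 0"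
    and "\<And>k l. C 0 1 k l = - a1 * C 1 2 k l"
    and "\<And>k l. (\<Sum>i\<le>6. C i 2 k l) = 0"
    and "\<And>k l. (\<Sum>i\<le>6. C i 1 k l) = - a0 * (\<Sum>i\<le>6. of_nat i * C i 2 k l)"
proof -
  define g where "g z w i j = (\<Sum>l\<le>6. \<Sum>k\<le>6. C i j k l * w ^ l * z ^ k)" for z w i j
  have q: "polyfun2 (\<lambda>X u. ev4 Q X u z w)" for Q z w
    by (intro polyfun2_ev4 polyfun2_intros)
  have g0: "(\<Sum>j\<le>6. \<Sum>i\<le>6. g z w i j * x ^ i * y ^ j) = ev4 Q0 (- ((x - 1) * y - a0) * y) (1 / y) z w"
    if "y \<noteq> 0" for x y z w
    using regular0[OF that] by (simp only: g_def flip: K_sum_xy)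
  have g1: "(\<Sum>j\<le>6. \<Sum>i\<le>6. g z w i j * x ^ i * y ^ j) = ev4 Q1 (- (x * y - a1) * y) (1 / y) z w"
    if "y \<noteq> 0" for x y z w
    using regular1[OF that] by (simp only: g_def flip: K_sum_xy)
  have deg: "g z w i j = 0" if "i + j > 6" for z w i j
    unfolding g_def using that by (simp add: beyond_degree)
  note two_points = bivariate_two_points[OF q q g0 g1 deg]
  have G1: "g z w i j = 0" if "j \<ge> 3" for z w i j
    by (rule two_points(1)) (use that in auto)
  have G2: "g z w 0 2 = 0" for z w
    by (rule two_points(2))
  have G3: "g z w 0 1 = - a1 * g z w 1 2" for z w
    by (rule two_points(3))
  have G4: "(\<Sum>i\<le>6. g z w i 2) = 0" for z w
    by (rule two_points(4))
  have G5: "(\<Sum>i\<le>6. g z w i 1) = - a0 * (\<Sum>i\<le>6. of_nat i * g z w i 2)" for z w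
    by (rule two_points(5))
  have vanish: "c k l = 0"
    if "\<And>z w. (\<Sum>l\<le>6. \<Sum>k\<le>6. c k l * w ^ l * z ^ k) = 0" "\<not> (k \<le> 6 \<and> l \<le> 6) \<Longrightarrow> c k l = 0"
    for c :: "nat \<Rightarrow> nat \<Rightarrow> Ct" and k l
    using coeffs_zero_if_function_zero[where n = 6 and c = "\<lambda>l k. c k l" and i = l and j = k] that by blast
  have big: "C i j k l = 0" if "\<not> (k \<le> 6 \<and> l \<le> 6)" for i j k l
    using that by (intro beyond_degree) auto
  show "C i j k l = 0" if "j \<ge> 3" for i j k l
    by (rule vanish[where c = "C i j", OF G1[OF that, unfolded g_def] big])
  show "C 0 2 k l = 0" for k l
    by (rule vanish[where c = "C 0 2", OF G2[unfolded g_def] big])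
  have "C 0 1 k l + a1 * C 1 2 k l = 0" for k l
  proof (rule vanish[where c = "\<lambda>k l. C 0 1 k l + a1 * C 1 2 k l"])
    fix z w
    have "(\<Sum>l\<le>6. \<Sum>k\<le>6. (C 0 1 k l + a1 * C 1 2 k l) * w ^ l * z ^ k) = g z w 0 1 + a1 * g z w 1 2"
      by (simp add: g_def sum_distrib_left sum.distrib algebra_simps)
    then show "(\<Sum>l\<le>6. \<Sum>k\<le>6. (C 0 1 k l + a1 * C 1 2 k l) * w ^ l * z ^ k) = 0"
      using G3[of z w] by simp
  qed (use big in simp)
  then show "C 0 1 k l = - a1 * C 1 2 k l" for k l
    by (simp add: eq_neg_iff_add_eq_0)
  show "(\<Sum>i\<le>6. C i 2 k l) = 0" for k l
  proof (rule vanish[where c = "\<lambda>k l. \<Sum>i\<le>6. C i 2 k l"])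
    fix z w
    have "(\<Sum>l\<le>6. \<Sum>k\<le>6. (\<Sum>i\<le>6. C i 2 k l) * w ^ l * z ^ k) = (\<Sum>i\<le>6. g z w i 2)"
      unfolding g_def sum_distrib_right by (rule sum_rotate)
    then show "(\<Sum>l\<le>6. \<Sum>k\<le>6. (\<Sum>i\<le>6. C i 2 k l) * w ^ l * z ^ k) = 0"
      using G4[of z w] by simp
  qed (use big in simp)
  have "(\<Sum>i\<le>6. C i 1 k l + a0 * (of_nat i * C i 2 k l)) = 0" for k l
  proof (rule vanish[where c = "\<lambda>k l. \<Sum>i\<le>6. C i 1 k l + a0 * (of_nat i * C i 2 k l)"])
    fix z w
    have "(\<Sum>l\<le>6. \<Sum>k\<le>6. (\<Sum>i\<le>6. C i 1 k l + a0 * (of_nat i * C i 2 k l)) * w ^ l * z ^ k)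
        = (\<Sum>i\<le>6. g z w i 1 + a0 * (of_nat i * g z w i 2))"
      unfolding g_def sum_distrib_right
      by (subst sum_rotate) (simp add: sum_distrib_left sum.distrib algebra_simps)
    also have "\<dots> = (\<Sum>i\<le>6. g z w i 1) + a0 * (\<Sum>i\<le>6. of_nat i * g z w i 2)"
      by (simp add: sum.distrib sum_distrib_left)
    finally show "(\<Sum>l\<le>6. \<Sum>k\<le>6. (\<Sum>i\<le>6. C i 1 k l + a0 * (of_nat i * C i 2 k l)) * w ^ l * z ^ k) = 0"
      using G5[of z w] by simp
  qed (use big in simp)
  then show "(\<Sum>i\<le>6. C i 1 k l) = - a0 * (\<Sum>i\<le>6. of_nat i * C i 2 k l)" for k l
    by (simp add: sum.distrib eq_neg_iff_add_eq_0 flip: sum_distrib_left)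
qed

text \<open>
  The same argument for the chart \<open>r3\<close>, with \<open>(x, y)\<close> fixed.
\<close>

lemma coeffs_zw:
  shows "\<And>i j k m. m \<ge> 3 \<Longrightarrow> C i j k (k + m) = 0"
    and "\<And>i j. C i j 0 2 = a3 ^ 2 * C i j 2 4"
    and "\<And>i j. C i j 1 3 = - 2 * a3 * C i j 2 4"
    and "\<And>i j. C i j 0 1 = - a3 * C i j 1 2 - a3 ^ 2 * C i j 2 3"
proof -
  define g where "g x y k l = (\<Sum>j\<le>6. \<Sum>i\<le>6. C i j k l * y ^ j * x ^ i)" for x y k l
  have q: "polyfun2 (\<lambda>X u. ev4 Q x y X u)" for Q x y
    by (intro polyfun2_ev4 polyfun2_intros)
  have g3: "(\<Sum>l\<le>6. \<Sum>k\<le>6. g x y k l * z ^ k * w ^ l) = ev4 Q3 x y (- (z * w - a3) * w) (1 / w)"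
    if "w \<noteq> 0" for x y z w
    using regular3[OF that] by (simp only: g_def flip: K_sum_zw)
  have deg: "g x y k l = 0" if "k + l > 6" for x y k l
    unfolding g_def using that by (simp add: beyond_degree)
  note one_point = bivariate_regular_coeffs[OF q g3 deg]
  have G1: "g x y k (k + m) = 0" if "m \<ge> 3" for x y k m
    by (rule one_point(1)) (use that in auto)
  have G2: "g x y 0 2 = a3 ^ 2 * g x y 2 4" for x y
    by (rule one_point(2))
  have G3: "g x y 1 3 = - 2 * a3 * g x y 2 4" for x y
    by (rule one_point(3))
  have G4: "g x y 0 1 = - a3 * g x y 1 2 - a3 ^ 2 * g x y 2 3" for x y
    by (rule one_point(4))
  have vanish: "c i j = 0"
    if "\<And>x y. (\<Sum>j\<le>6. \<Sum>i\<le>6. c i j * y ^ j * x ^ i) = 0" "\<not> (i \<le> 6 \<and> j \<le> 6) \<Longrightarrow> c i j = 0"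
    for c :: "nat \<Rightarrow> nat \<Rightarrow> Ct" and i j
    using coeffs_zero_if_function_zero[where n = 6 and c = "\<lambda>j i. c i j" and i = j and j = i] that by blast
  have big: "C i j k l = 0" if "\<not> (i \<le> 6 \<and> j \<le> 6)" for i j k l
    using that by (intro beyond_degree) auto
  show "C i j k (k + m) = 0" if "m \<ge> 3" for i j k m
    by (rule vanish[where c = "\<lambda>i j. C i j k (k + m)", OF G1[OF that, unfolded g_def] big])
  have "C i j 0 2 - a3 ^ 2 * C i j 2 4 = 0" for i j
  proof (rule vanish[where c = "\<lambda>i j. C i j 0 2 - a3 ^ 2 * C i j 2 4"])
    fix x y
    have "(\<Sum>j\<le>6. \<Sum>i\<le>6. (C i j 0 2 - a3 ^ 2 * C i j 2 4) * y ^ j * x ^ i) = g x y 0 2 - a3 ^ 2 * g x y 2 4"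
      by (simp add: g_def sum_distrib_left sum_subtractf algebra_simps)
    then show "(\<Sum>j\<le>6. \<Sum>i\<le>6. (C i j 0 2 - a3 ^ 2 * C i j 2 4) * y ^ j * x ^ i) = 0"
      using G2[of x y] by simp
  qed (use big in simp)
  then show "C i j 0 2 = a3 ^ 2 * C i j 2 4" for i j by simp
  have "C i j 1 3 + 2 * a3 * C i j 2 4 = 0" for i j
  proof (rule vanish[where c = "\<lambda>i j. C i j 1 3 + 2 * a3 * C i j 2 4"])
    fix x y
    have "(\<Sum>j\<le>6. \<Sum>i\<le>6. (C i j 1 3 + 2 * a3 * C i j 2 4) * y ^ j * x ^ i) = g x y 1 3 + 2 * a3 * g x y 2 4"
      by (simp add: g_def sum_distrib_left sum.distrib algebra_simps)
    then show "(\<Sum>j\<le>6. \<Sum>i\<le>6. (C i j 1 3 + 2 * a3 * C i j 2 4) * y ^ j * x ^ i) = 0"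
      using G3[of x y] by simp
  qed (use big in simp)
  then show "C i j 1 3 = - 2 * a3 * C i j 2 4" for i j
    by (simp add: eq_neg_iff_add_eq_0)
  have rel: "C i j 0 1 + a3 * C i j 1 2 + a3 ^ 2 * C i j 2 3 = 0" for i j
  proof (rule vanish[where c = "\<lambda>i j. C i j 0 1 + a3 * C i j 1 2 + a3 ^ 2 * C i j 2 3"])
    fix x y
    have "(\<Sum>j\<le>6. \<Sum>i\<le>6. (C i j 0 1 + a3 * C i j 1 2 + a3 ^ 2 * C i j 2 3) * y ^ j * x ^ i)
        = g x y 0 1 + a3 * g x y 1 2 + a3 ^ 2 * g x y 2 3"
      by (simp add: g_def sum_distrib_left sum.distrib algebra_simps)
    then show "(\<Sum>j\<le>6. \<Sum>i\<le>6. (C i j 0 1 + a3 * C i j 1 2 + a3 ^ 2 * C i j 2 3) * y ^ j * x ^ i) = 0"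
      using G4[of x y] by simp
  qed (use big in simp)
  show "C i j 0 1 = - a3 * C i j 1 2 - a3 ^ 2 * C i j 2 3" for i j
    using rel[of i j] by algebra
qed

section \<open>The leading form in \<open>x\<close> and \<open>z\<close>\<close>

text \<open>
  On \<open>v = 0\<close>, the locus that \<open>r2\<close> adds, the original coordinate \<open>y\<close> is \<open>1 / c\<close>; this is \<open>c\<close> as a
  polynomial in \<open>w\<close>.
\<close>

definition cp :: "Ct poly" where "cp = [:t, 0, - 1:]"

lemma poly_cp [simp]: "poly cp w = t - w ^ 2"
  by (simp add: cp_def power2_eq_square)

lemma cp_nonzero [simp]: "cp \<noteq> 0"
  by (simp add: cp_def)

lemma degree_cp [simp]: "degree cp = 2"
  by (simp add: cp_def)

lemma finite_cp_roots: "finite {w. t - w ^ 2 = 0}"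
  using poly_roots_finite[OF cp_nonzero] by simp

text \<open>
  The polynomials \<open>t - w^2\<close> and \<open>w\<close> are coprime because \<open>t - w^2\<close> has the value \<open>t \<noteq> 0\<close> at \<open>w = 0\<close>.
\<close>

lemma cp_power_dvd_cancel: "cp ^ m dvd p * [:0, 1:] ^ n \<Longrightarrow> cp ^ m dvd p"
proof (induction n)
  case (Suc n)
  from Suc.prems obtain r where r: "p * [:0, 1:] ^ n * [:0, 1:] = cp ^ m * r"
    by (auto elim!: dvdE simp: mult_ac)
  then have "poly (p * [:0, 1:] ^ n * [:0, 1:]) 0 = poly (cp ^ m * r) 0" by simp
  then have "poly r 0 = 0" using t_nonzero by simp
  then obtain r' where "r = [:0, 1:] * r'" by (auto simp: poly_eq_0_iff_dvd elim: dvdE)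
  with r have "p * [:0, 1:] ^ n = cp ^ m * r'"
    by (simp add: mult.left_commute[of _ "[:0, 1:]"] mult.commute[of _ "[:0, 1:]"])
  then show ?case using Suc.IH by simp
qed simp

definition row :: "nat \<Rightarrow> nat \<Rightarrow> nat \<Rightarrow> Ct poly" where
  "row i j k = (\<Sum>l\<le>6. monom (C i j k l) l)"

lemma coeff_row [simp]: "coeff (row i j k) l = C i j k l"
proof -
  have "coeff (row i j k) l = (\<Sum>l'\<le>6. if l' = l then C i j k l else 0)"
    unfolding row_def coeff_sum by (intro sum.cong) auto
  then show ?thesis using beyond_degree[of i j k l] by auto
qed

lemma row_eq_0_iff: "row i j k = 0 \<longleftrightarrow> (\<forall>l. C i j k l = 0)"
  by (simp add: poly_eq_iff)

lemma poly_row: "poly (row i j k) w = (\<Sum>l\<le>6. C i j k l * w ^ l)"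
  by (simp add: row_def poly_sum poly_monom)

lemma degree_row: "degree (row i j k) \<le> 6 - i - j - k"
  by (rule degree_le) (auto intro!: beyond_degree)

lemma K_rows: "ev4 K x y z w = (\<Sum>k\<le>6. \<Sum>j\<le>2. \<Sum>i\<le>6. poly (row i j k) w * x ^ i * y ^ j * z ^ k)"
proof -
  have "ev4 K x y z w = (\<Sum>l\<le>6. \<Sum>k\<le>6. \<Sum>j\<le>2. \<Sum>i\<le>6. C i j k l * x ^ i * y ^ j * z ^ k * w ^ l)"
    unfolding K_sum by (intro sum.cong refl sum.mono_neutral_right) (auto simp: coeffs_xy(1))
  also have "\<dots> = (\<Sum>k\<le>6. \<Sum>l\<le>6. \<Sum>j\<le>2. \<Sum>i\<le>6. C i j k l * x ^ i * y ^ j * z ^ k * w ^ l)"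
    by (rule sum.swap)
  also have "\<dots> = (\<Sum>k\<le>6. \<Sum>j\<le>2. \<Sum>l\<le>6. \<Sum>i\<le>6. C i j k l * x ^ i * y ^ j * z ^ k * w ^ l)"
    by (rule sum.cong[OF refl], rule sum.swap)
  also have "\<dots> = (\<Sum>k\<le>6. \<Sum>j\<le>2. \<Sum>i\<le>6. \<Sum>l\<le>6. C i j k l * x ^ i * y ^ j * z ^ k * w ^ l)"
    by (rule sum.cong[OF refl], rule sum.cong[OF refl], rule sum.swap)
  finally show ?thesis
    by (simp add: poly_row sum_distrib_left sum_distrib_right mult_ac)
qed

text \<open>
  The chart \<open>r2\<close> solved for the original coordinates, with \<open>v = 1 / X\<close> and
  \<open>s = (1/y + w^2 - t) X\<close> in place of the second new coordinate, which is \<open>(- a2 - s) / v\<close>. The new third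
  coordinate is \<open>\<zeta>\<close>.
\<close>

lemma regular2_chart:
  assumes v: "v \<noteq> 0" and u: "t - w ^ 2 + s * v \<noteq> 0"
  shows "ev4 K (- (t - w ^ 2 + s * v) * (t - w ^ 2 + (s - a1) * v) / v) (1 / (t - w ^ 2 + s * v))
      (\<zeta> + 2 * w / v) w + 1 / v = ev4 Q2 v ((- a2 - s) / v) \<zeta> w"
proof -
  define u where "u = t - w ^ 2 + s * v"
  define x where "x = - u * (t - w ^ 2 + (s - a1) * v) / v"
  have "u \<noteq> 0" using u by (simp add: u_def)
  have ts: "t - w ^ 2 + (s - a1) * v = u - a1 * v" by (simp add: u_def algebra_simps)
  have X: "1 / v = - (x * (1 / u) - a1) * (1 / u)"
    using v \<open>u \<noteq> 0\<close> unfolding x_def ts by (simp add: field_simps)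
  have "ev4 K x (1 / u) (\<zeta> + 2 * w / v) w + 1 / v
    = ev4 Q2 (1 / (1 / v)) (- ((1 / (1 / u) + w ^ 2 - t) * (1 / v) + a2) * (1 / v))
        (\<zeta> + 2 * w / v - 2 * (1 / v) * w) w"
    using v \<open>u \<noteq> 0\<close> by (intro regular2 X) auto
  moreover have "- ((1 / (1 / u) + w ^ 2 - t) * (1 / v) + a2) * (1 / v) = (- a2 - s) / v"
    using v by (simp add: u_def field_simps)
  moreover have "\<zeta> + 2 * w / v - 2 * (1 / v) * w = \<zeta>" by simp
  moreover have "1 / (1 / v) = v" by simp
  ultimately show ?thesis
    by (simp only: x_def u_def)
qed

text \<open>
  The coefficient of \<open>x^i z^k\<close> in \<open>K\<close> at \<open>y = 1/c\<close>, multiplied by \<open>c^2\<close> to clear denominators; it is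
  a polynomial in \<open>w\<close>.
\<close>

definition lead :: "nat \<Rightarrow> nat \<Rightarrow> Ct poly" where
  "lead i k = row i 2 k + cp * row i 1 k + cp ^ 2 * row i 0 k"

text \<open>
  On the surface \<open>s = - a2\<close>, where the second coordinate of \<open>r2\<close> is 0, put \<open>\<zeta> = - s' / v\<close>. Then
  \<open>x = - u e / v\<close> and \<open>z = (2 w - s') / v\<close> with \<open>u\<close> and \<open>e\<close> equal to \<open>c\<close> at \<open>v = 0\<close>, so the coefficient of
  \<open>v^(-N)\<close> in \<open>K\<close> is the leading form at \<open>(- c^2, 1/c, 2 w - s', w)\<close>. By \<open>blowup_dvd\<close> with \<open>a = 0\<close> it is
  divisible by \<open>s'^N\<close>, and its degree in \<open>s'\<close> is at most \<open>N\<close>. The summand \<open>X = 1 / v\<close> does not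
  interfere because \<open>N \<ge> 2\<close>.
\<close>

lemma lead_coeffs_at:
  assumes N: "2 \<le> N" "N \<le> 6" and zero: "\<And>i j k l. i + k > N \<Longrightarrow> C i j k l = 0"
    and w: "t - w ^ 2 \<noteq> 0" and k: "k \<le> N"
  shows "poly (lead (N - k) k) w * (- ((t - w ^ 2) ^ 2)) ^ (N - k)
    = poly (lead 0 N) w * of_nat (N choose k) * (- (2 * w)) ^ (N - k)"
proof -
  define c where "c = t - w ^ 2"
  have "c \<noteq> 0" using w by (simp add: c_def)
  \<comment> \<open>The inner variable is \<open>s'\<close>, the outer one \<open>v\<close>; \<open>U\<close> stands for \<open>1 / y\<close>, \<open>E\<close> for \<open>- x y v\<close> and \<open>Z\<close> for \<open>z v\<close>.\<close>
  define U :: "Ct poly poly" where "U = [:[:c:], [:- a2:]:]"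
  define E :: "Ct poly poly" where "E = [:[:c:], [:- a2 - a1:]:]"
  define Z :: "Ct poly poly" where "Z = [:[:2 * w, -1:]:]"
  define M :: "nat \<Rightarrow> nat \<Rightarrow> nat \<Rightarrow> Ct poly poly" where
    "M k j i = (if i + k \<le> N then [:[:poly (row i j k) w:]:] * (- (U * E)) ^ i * U ^ (2 - j) * Z ^ k * monom 1 (N - i - k) else 0)"
    for k j i
  \<comment> \<open>This is \<open>v^N (K + 1 / v)\<close>, multiplied by \<open>U^2\<close> because \<open>K\<close> is quadratic in \<open>y = 1 / U\<close>.\<close>
  define G where "G = (\<Sum>k\<le>6. \<Sum>j\<le>2. \<Sum>i\<le>6. M k j i) + U ^ 2 * monom 1 (N - 1)"
  have G: "poly (poly G [:v:]) (0 - \<zeta> * v) = v ^ N * ((c - a2 * v) ^ 2 * ev4 Q2 v 0 \<zeta> w)"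
    if "v \<noteq> 0" "c - a2 * v \<noteq> 0" for v \<zeta>
  proof -
    define u where "u = c - a2 * v"
    define e where "e = c + (- a2 - a1) * v"
    have "u \<noteq> 0" using that by (simp add: u_def)
    have "poly (poly (M k j i) [:v:]) (0 - \<zeta> * v)
        = v ^ N * u ^ 2 * (poly (row i j k) w * (- u * e / v) ^ i * (1 / u) ^ j * (\<zeta> + 2 * w / v) ^ k)"
      if "j \<le> 2" for k j i
    proof (cases "i + k \<le> N")
      case True
      then have "v ^ N = v ^ (N - i - k) * v ^ i * v ^ k"
        by (simp flip: power_add)
      moreover have "u ^ 2 = u ^ (2 - j) * u ^ j"
        using that by (simp flip: power_add)
      moreover have "(\<zeta> + 2 * w / v) ^ k * v ^ k = (2 * w + \<zeta> * v) ^ k"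
        using \<open>v \<noteq> 0\<close> by (simp add: field_simps flip: power_mult_distrib)
      moreover have "(- u * e / v) ^ i * v ^ i = (- (u * e)) ^ i"
        using \<open>v \<noteq> 0\<close> by (simp flip: power_mult_distrib)
      moreover have "(1 / u) ^ j * u ^ j = 1"
        using \<open>u \<noteq> 0\<close> by (simp flip: power_mult_distrib)
      moreover have "poly (poly (M k j i) [:v:]) (0 - \<zeta> * v)
          = poly (row i j k) w * (- (u * e)) ^ i * u ^ (2 - j) * (2 * w + \<zeta> * v) ^ k * v ^ (N - i - k)"
        using True by (simp add: M_def U_def E_def Z_def u_def e_def poly_monom algebra_simps)
      ultimately show ?thesis
        by (smt (verit, ccfv_threshold) mult.commute mult.assoc mult.right_neutral)
    next
      case False
      then have "row i j k = 0" by (simp add: row_eq_0_iff zero)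
      then show ?thesis using False by (simp add: M_def)
    qed
    then have "poly (poly (\<Sum>k\<le>6. \<Sum>j\<le>2. \<Sum>i\<le>6. M k j i) [:v:]) (0 - \<zeta> * v)
        = v ^ N * u ^ 2 * ev4 K (- u * e / v) (1 / u) (\<zeta> + 2 * w / v) w"
      unfolding K_rows sum_distrib_left poly_sum
      by (intro sum.cong refl) (simp add: mult.assoc)
    moreover have "poly (poly (U ^ 2 * monom 1 (N - 1)) [:v:]) (0 - \<zeta> * v) = v ^ N * u ^ 2 * (1 / v)"
    proof -
      have "v ^ N = v ^ (N - 1) * v" using N by (simp flip: power_Suc2)
      then show ?thesis
        using \<open>v \<noteq> 0\<close> by (simp add: U_def u_def poly_monom mult_ac)
    qed
    ultimately have "poly (poly G [:v:]) (0 - \<zeta> * v)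
        = v ^ N * u ^ 2 * (ev4 K (- u * e / v) (1 / u) (\<zeta> + 2 * w / v) w + 1 / v)"
      by (simp add: G_def distrib_left)
    also have "ev4 K (- u * e / v) (1 / u) (\<zeta> + 2 * w / v) w + 1 / v = ev4 Q2 v 0 \<zeta> w"
      using regular2_chart[of v w "- a2" \<zeta>] that by (simp add: u_def e_def c_def)
    finally show ?thesis by (simp add: u_def mult.assoc)
  qed
  have dvd: "[:- 0, 1:] ^ (N - 0) dvd coeff G 0"
  proof (rule blowup_dvd)
    show "polyfun2 (\<lambda>\<zeta> v. (c - a2 * v) ^ 2 * ev4 Q2 v 0 \<zeta> w)"
      by (intro polyfun2_intros polyfun2_ev4)
    have "finite {v. poly [:c, - a2:] v = 0}"
      by (rule poly_roots_finite) (use \<open>c \<noteq> 0\<close> in simp)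
    then have "finite ({0} \<union> {v. poly [:c, - a2:] v = 0})" by simp
    then show "finite {v. poly (poly G [:v:]) (0 - \<zeta> * v) \<noteq> v ^ N * ((c - a2 * v) ^ 2 * ev4 Q2 v 0 \<zeta> w)}" for \<zeta>
      by (rule rev_finite_subset) (use G in \<open>auto simp: mult.commute\<close>)
  qed (use N in simp)
  have "poly (coeff G 0) s = (\<Sum>k\<le>N. poly (lead (N - k) k) w * (- (c ^ 2)) ^ (N - k) * (2 * w - s) ^ k)" for s
  proof -
    define F where "F k j i = poly (row i j k) w * (- (c ^ 2)) ^ i * c ^ (2 - j) * (2 * w - s) ^ k" for k j i
    have M0: "poly (poly (M k j i) 0) s = (if i = N - k \<and> k \<le> N then F k j i else 0)" for k j i
      by (auto simp: M_def U_def E_def Z_def poly_monom F_def power2_eq_square)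
    have "poly (coeff G 0) s = (\<Sum>k\<le>6. \<Sum>j\<le>2. \<Sum>i\<le>6. if i = N - k \<and> k \<le> N then F k j i else 0)"
      using N by (simp add: G_def poly_sum M0 poly_monom flip: poly_0_coeff_0)
    also have "\<dots> = (\<Sum>k\<le>6. \<Sum>j\<le>2. if k \<le> N then F k j (N - k) else 0)"
      using N by (intro sum.cong refl) auto
    also have "\<dots> = (\<Sum>k\<le>6. if k \<le> N then \<Sum>j\<le>2. F k j (N - k) else 0)"
      by (intro sum.cong refl) auto
    also have "\<dots> = (\<Sum>k\<le>N. \<Sum>j\<le>2. F k j (N - k))"
      using N by (intro sum.mono_neutral_cong_right) auto
    also have "\<dots> = (\<Sum>k\<le>N. poly (lead (N - k) k) w * (- (c ^ 2)) ^ (N - k) * (2 * w - s) ^ k)"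
      by (intro sum.cong refl) (simp add: F_def lead_def c_def algebra_simps numeral_2_eq_2)
    finally show ?thesis .
  qed
  then have "poly (lead (N - k) k) w * (- (c ^ 2)) ^ (N - k)
      = poly (lead (N - N) N) w * (- (c ^ 2)) ^ (N - N) * of_nat (N choose k) * (- (2 * w)) ^ (N - k)"
    using binomial_coeffs_if_dvd[where p = "coeff G 0" and n = N and b = "2 * w" and k = k
      and \<beta> = "\<lambda>k. poly (lead (N - k) k) w * (- (c ^ 2)) ^ (N - k)"] dvd k
    by simp
  then show ?thesis by (simp add: c_def)
qed

text \<open>
  The pointwise relations hold for all \<open>w\<close> outside the zeros of \<open>c\<close>, hence as identities of polynomials in
  \<open>w\<close>. They say that the leading form at \<open>y = 1/c\<close> is a multiple of \<open>(z + 2 w x / c^2)^N\<close>.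
\<close>

lemma lead_coeffs:
  assumes N: "2 \<le> N" "N \<le> 6" and zero: "\<And>i j k l. i + k > N \<Longrightarrow> C i j k l = 0" and k: "k \<le> N"
  shows "lead (N - k) k * cp ^ (2 * (N - k))
    = smult (of_nat (N choose k) * 2 ^ (N - k)) (lead 0 N * [:0, 1:] ^ (N - k))"
proof (rule poly_eqI_cofinite)
  have "poly (lead (N - k) k * cp ^ (2 * (N - k))) w
      = poly (smult (of_nat (N choose k) * 2 ^ (N - k)) (lead 0 N * [:0, 1:] ^ (N - k))) w"
    if "t - w ^ 2 \<noteq> 0" for w
  proof -
    have "(- 1) ^ (N - k) * (poly (lead (N - k) k) w * (t - w ^ 2) ^ (2 * (N - k)))
      = (- 1) ^ (N - k) * (poly (lead 0 N) w * of_nat (N choose k) * (2 * w) ^ (N - k))"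
      using lead_coeffs_at[OF N zero that k]
      unfolding power_minus[of "(t - w ^ 2) ^ 2"] power_minus[of "2 * w"] by (simp add: mult_ac flip: power_mult)
    then show ?thesis
      by (simp add: power_mult_distrib mult_ac)
  qed
  then show "finite {w. poly (lead (N - k) k * cp ^ (2 * (N - k))) w
      \<noteq> poly (smult (of_nat (N choose k) * 2 ^ (N - k)) (lead 0 N * [:0, 1:] ^ (N - k))) w}"
    by (intro finite_subset[OF _ finite_cp_roots]) auto
qed

text \<open>
  Comparing the coefficients of \<open>z^N\<close> and \<open>x^N\<close> shows that \<open>c^(2 N - 2)\<close> divides the coefficient \<open>row 0 0 N\<close> of
  \<open>z^N\<close>, whose degree, at most \<open>6 - N\<close>, is smaller than \<open>4 N - 4\<close>. So the leading form vanishes at \<open>y = 1/c\<close>. Its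
  \<open>y^2\<close> part is then divisible by \<open>c\<close>, which has degree 2, but has degree at most \<open>4 - N\<close> in \<open>w\<close>.
\<close>

lemma lead_zero:
  assumes N: "3 \<le> N" "N \<le> 6" and zero: "\<And>i j k l. i + k > N \<Longrightarrow> C i j k l = 0" and k: "k \<le> N"
  shows "row (N - k) 2 k = 0" "row (N - k) 1 k = - cp * row (N - k) 0 k"
proof -
  have "row 0 2 N = 0" "row 0 1 N = 0"
    using coeffs_xy(2)[of N] coeffs_xy(3)[of N] zero by (simp_all add: row_eq_0_iff)
  then have lead0: "lead 0 N = cp ^ 2 * row 0 0 N" by (simp add: lead_def)
  have "lead N 0 * cp ^ (2 * N) = smult (2 ^ N) (lead 0 N * [:0, 1:] ^ N)"
    using lead_coeffs[of N 0] N zero by simp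
  moreover have "cp ^ (2 * N) = cp ^ 2 * cp ^ (2 * N - 2)"
    by (subst power_add[symmetric], subst le_add_diff_inverse) (use N in simp_all)
  ultimately have "cp ^ 2 * (lead N 0 * cp ^ (2 * N - 2)) = cp ^ 2 * smult (2 ^ N) (row 0 0 N * [:0, 1:] ^ N)"
    by (simp add: lead0 mult_ac)
  then have "lead N 0 * cp ^ (2 * N - 2) = smult (2 ^ N) (row 0 0 N * [:0, 1:] ^ N)"
    by (subst (asm) mult_cancel_left) simp
  then have "cp ^ (2 * N - 2) dvd smult (2 ^ N) (row 0 0 N * [:0, 1:] ^ N)"
    by (metis dvd_triv_right)
  then have "cp ^ (2 * N - 2) dvd row 0 0 N * [:0, 1:] ^ N"
    by (rule dvd_smult_cancel) simp
  then have dvd: "cp ^ (2 * N - 2) dvd row 0 0 N"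
    by (rule cp_power_dvd_cancel)
  have "row 0 0 N = 0"
  proof (rule ccontr)
    assume "row 0 0 N \<noteq> 0"
    from dvd_imp_degree_le[OF dvd this] have "2 * (2 * N - 2) \<le> 6 - N"
      using degree_row[of 0 0 N] by (simp add: degree_power_eq mult.commute)
    then show False using N by simp
  qed
  then have "lead 0 N = 0" by (simp add: lead0)
  then have "lead (N - k) k = 0"
    using lead_coeffs[of N k] N zero k by simp
  then have eq: "row (N - k) 2 k = - cp * (row (N - k) 1 k + cp * row (N - k) 0 k)"
    unfolding lead_def by (simp add: algebra_simps power2_eq_square eq_neg_iff_add_eq_0)
  show "row (N - k) 2 k = 0"
  proof (rule ccontr)
    assume "row (N - k) 2 k \<noteq> 0"
    moreover have "cp dvd row (N - k) 2 k" unfolding eq by simp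
    ultimately have "degree cp \<le> degree (row (N - k) 2 k)"
      by (intro dvd_imp_degree_le)
    then show False using degree_row[of "N - k" 2 k] N k by simp
  qed
  then show "row (N - k) 1 k = - cp * row (N - k) 0 k"
    using eq by (simp add: eq_neg_iff_add_eq_0)
qed

text \<open>
  Descending induction on the degree \<open>i + k\<close> in \<open>x, z\<close>, started by the total degree. In degree
  \<open>N \<ge> 4\<close> the relation \<open>row i 1 k = - c row i 0 k\<close> also forces both sides to vanish, since the left-hand
  side has degree at most \<open>5 - N < 2\<close> in \<open>w\<close>.
\<close>

lemma C_zero_if_ge_4:
  assumes "4 \<le> i + k"
  shows "C i j k l = 0"
proof -
  have step: "\<And>i j k l. i + k \<ge> N \<Longrightarrow> C i j k l = 0"
    if N: "4 \<le> N" "N \<le> 6" and zero: "\<And>i j k l. i + k > N \<Longrightarrow> C i j k l = 0" for N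
  proof -
    fix i j k l assume "i + k \<ge> N"
    show "C i j k l = 0"
    proof (cases "i + k = N")
      case True
      then have i: "i = N - k" "k \<le> N" by auto
      have T: "row i 2 k = 0" "row i 1 k = - cp * row i 0 k"
        using lead_zero[of N k] N zero i by simp_all
      have "row i 0 k = 0"
      proof (rule ccontr)
        assume "row i 0 k \<noteq> 0"
        then have "degree (row i 1 k) = 2 + degree (row i 0 k)"
          unfolding T(2) by (subst degree_mult_eq) simp_all
        then show False using degree_row[of i 1 k] True N by simp
      qed
      with T have "row i 0 k = 0" "row i 1 k = 0" "row i 2 k = 0" by simp_all
      moreover have "j = 0 \<or> j = 1 \<or> j = 2 \<or> j \<ge> 3" by auto
      ultimately show ?thesis
        using coeffs_xy(1) by (auto simp: row_eq_0_iff)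
    qed (use \<open>i + k \<ge> N\<close> zero in simp)
  qed
  have 6: "C i j k l = 0" if "i + k \<ge> 6" for i j k l
    using that by (rule step[rotated 3]) (auto intro!: beyond_degree)
  have 5: "C i j k l = 0" if "i + k \<ge> 5" for i j k l
    using that by (rule step[rotated 3]) (auto intro!: 6)
  show ?thesis
    using assms by (rule step[rotated 3]) (auto intro!: 5)
qed

section \<open>The cubic leading form and an explicit normal form\<close>

text \<open>
  In degree 3 the row of \<open>y\<close> has degree at most 2 in \<open>w\<close>, so the relation \<open>row i 1 k = - c row i 0 k\<close> leaves one
  constant for each of the four cubic monomials \<open>x^i z^k\<close>.
\<close>

lemma cubic_rows:
  assumes "i + k = 3"
  shows "row i 2 k = 0" and "row i 1 k = - cp * row i 0 k" and "row i 0 k = [:C i 0 k 0:]"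
proof -
  have i: "i = 3 - k" "k \<le> 3" using assms by auto
  show "row i 2 k = 0" and T: "row i 1 k = - cp * row i 0 k"
    using lead_zero[of 3 k] C_zero_if_ge_4 i by simp_all
  have "degree (row i 0 k) = 0"
  proof (cases "row i 0 k = 0")
    case False
    then have "degree (row i 1 k) = 2 + degree (row i 0 k)"
      unfolding T by (subst degree_mult_eq) simp_all
    then show ?thesis using degree_row[of i 1 k] assms by simp
  qed simp
  then obtain b where b: "row i 0 k = [:b:]" using degree_eq_zeroE by blast
  then have "b = C i 0 k 0" by (metis coeff_pCons_0 coeff_row)
  with b show "row i 0 k = [:C i 0 k 0:]" by simp
qed

text \<open>
  For \<open>z^3\<close> and \<open>x z^2\<close> the coefficient of \<open>y\<close> is zero by \<open>coeffs_xy\<close>; for \<open>x^3\<close> the coefficient of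
  \<open>y w^2\<close> is zero by \<open>coeffs_zw\<close>.
\<close>

lemma cubic_coeffs:
  assumes "i + k = 3" "k \<noteq> 1"
  shows "C i j k l = 0"
proof -
  note [simp del] = One_nat_def
  have top: "C i 1 k 2 = C i 0 k 0"
    by (subst coeff_row[symmetric], subst cubic_rows(2)[OF assms(1)], subst cubic_rows(3)[OF assms(1)])
      (simp add: cp_def numeral_2_eq_2)
  have "C i 1 k 2 = 0"
  proof -
    consider "i = 0" "k = 3" | "i = 1" "k = 2" | "i = 3" "k = 0"
      using assms by linarith
    then show ?thesis
    proof cases
      case 1
      then show ?thesis using coeffs_xy(3)[of 3 2] C_zero_if_ge_4[of 1 3] by simp
    next
      case 2
      have "C 1 2 2 2 = 0"
        using cubic_rows(1)[of 1 2] by (simp add: row_eq_0_iff)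
      moreover have "C i j 2 2 = 0" if "i \<ge> 2" for i j
        using C_zero_if_ge_4[of i 2] that by simp
      ultimately show ?thesis
        using coeffs_xy(2)[of 2 2] coeffs_xy(3)[of 2 2] coeffs_xy(5)[of 2 2] 2
        by (simp add: sum_upto_6)
    next
      case 3
      then show ?thesis using coeffs_zw(2)[of 3 1] C_zero_if_ge_4[of 3 2] by simp
    qed
  qed
  with top have "C i 0 k 0 = 0" by simp
  then have "row i 0 k = 0" "row i 1 k = 0" "row i 2 k = 0"
    using cubic_rows[OF assms(1)] by simp_all
  moreover have "j = 0 \<or> j = 1 \<or> j = 2 \<or> j \<ge> 3" by auto
  ultimately show ?thesis
    using coeffs_xy(1) by (auto simp: row_eq_0_iff)
qed

lemma cubic_coeffs_1:
  "C 2 2 1 l = 0" "row 2 1 1 = [:- t * C 2 0 1 0, 0, C 2 0 1 0:]" "row 2 0 1 = [:C 2 0 1 0:]"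
proof -
  note [simp del] = One_nat_def
  show "C 2 2 1 l = 0" using cubic_rows(1)[of 2 1] by (simp add: row_eq_0_iff)
  show "row 2 0 1 = [:C 2 0 1 0:]" using cubic_rows(3)[of 2 1] by simp
  then show "row 2 1 1 = [:- t * C 2 0 1 0, 0, C 2 0 1 0:]"
    using cubic_rows(2)[of 2 1] by (simp add: cp_def)
qed

lemma C_zero_if_w_large: "l \<ge> k + 3 \<Longrightarrow> C i j k l = 0"
  using coeffs_zw(1)[of "l - k" i j k] by simp

lemma row_k0: "row i j 0 = [:C i j 0 0, - a3 * C i j 1 2 - a3 ^ 2 * C i j 2 3, a3 ^ 2 * C i j 2 4:]"
proof -
  have z: "C i j 0 3 = 0" "C i j 0 4 = 0" "C i j 0 5 = 0" "C i j 0 6 = 0"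
    by (simp_all add: C_zero_if_w_large)
  show ?thesis
    unfolding row_def sum_upto_6 z coeffs_zw(2,4) monom_list monom_0 by simp
qed

lemma row_k1: "row i j 1 = [:C i j 1 0, C i j 1 1, C i j 1 2, - 2 * a3 * C i j 2 4:]"
proof -
  have z: "C i j 1 4 = 0" "C i j 1 5 = 0" "C i j 1 6 = 0"
    by (simp_all add: C_zero_if_w_large)
  show ?thesis
    unfolding row_def sum_upto_6 z coeffs_zw(3) monom_list monom_0 by simp
qed

lemma row_002: "row 0 0 2 = [:C 0 0 2 0, C 0 0 2 1, C 0 0 2 2, C 0 0 2 3, C 0 0 2 4:]"
proof -
  have z: "C 0 0 2 5 = 0" "C 0 0 2 6 = 0"
    by (simp_all add: beyond_degree)
  show ?thesis
    unfolding row_def sum_upto_6 z monom_list monom_0 by simp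
qed

lemma rows_y2:
  "row 0 2 k = 0" "row 1 2 0 = [:- C 2 2 0 0:]" "row 2 2 0 = [:C 2 2 0 0:]" "row 1 2 1 = 0" "row 2 2 1 = 0"
proof -
  note [simp del] = One_nat_def
  show "row 0 2 k = 0" by (simp add: row_eq_0_iff coeffs_xy(2))
  have z: "C 2 2 1 l = 0" "C 2 2 2 l = 0" "C 1 2 2 l = 0" for l
    using cubic_coeffs_1(1) C_zero_if_ge_4[of 2 2] cubic_coeffs[of 1 2] by simp_all
  show "row 2 2 1 = 0" by (simp add: row_eq_0_iff z)
  show R: "row 2 2 0 = [:C 2 2 0 0:]"
    unfolding row_k0[of 2 2] by (simp add: z)
  have high: "C i 2 1 l = 0" "C i 2 0 l = 0" if "i \<ge> 3" for i l
    using that C_zero_if_ge_4[of i 1] C_zero_if_ge_4[of i 0] cubic_coeffs[of 3 0 2 l] by (cases "i = 3"; simp)+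
  have s: "C 1 2 1 l = 0" "C 1 2 0 l = - C 2 2 0 l" for l
    using coeffs_xy(2)[of 1 l] coeffs_xy(4)[of 1 l] coeffs_xy(2)[of 0 l] coeffs_xy(4)[of 0 l]
    by (simp_all add: sum_upto_6 high z eq_neg_iff_add_eq_0)
  show "row 1 2 1 = 0" by (simp add: row_eq_0_iff s)
  have "row 1 2 0 = - row 2 2 0" by (intro poly_eqI) (simp add: s)
  then show "row 1 2 0 = [:- C 2 2 0 0:]" by (simp add: R)
qed

lemma rows_y1:
  "row 0 1 0 = [:a1 * C 2 2 0 0:]" "row 0 1 1 = 0" "row 0 1 2 = 0"
  "row 1 1 0 = [:- (a0 + a1) * C 2 2 0 0 - C 2 1 0 0, a3 * C 2 0 1 0:]"
  "row 2 1 0 = [:C 2 1 0 0, - a3 * C 2 0 1 0:]"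
  "row 1 1 1 = [:t * C 2 0 1 0, 0, - C 2 0 1 0:]"
proof -
  note [simp del] = One_nat_def
  have z: "C 2 2 1 l = 0" "C 2 2 2 l = 0" "C 1 2 2 l = 0" "C 1 2 1 l = 0" "C 2 1 2 l = 0" for l
    using cubic_coeffs_1(1) C_zero_if_ge_4[of 2 2] cubic_coeffs[of 1 2] rows_y2(4)
    by (simp_all add: row_eq_0_iff)
  have c0: "C 0 1 k l = - a1 * C 1 2 k l" for k l by (fact coeffs_xy(3))
  have "row 0 1 k = smult (- a1) (row 1 2 k)" for k
    by (intro poly_eqI) (simp add: c0)
  then show R0: "row 0 1 0 = [:a1 * C 2 2 0 0:]" "row 0 1 1 = 0" "row 0 1 2 = 0"
    using rows_y2(2,4) by (simp_all add: row_eq_0_iff z)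
  have "C 2 1 1 2 = coeff (row 2 1 1) 2" by simp
  also have "\<dots> = C 2 0 1 0" unfolding cubic_coeffs_1(2) by (simp add: numeral_2_eq_2)
  finally show R2: "row 2 1 0 = [:C 2 1 0 0, - a3 * C 2 0 1 0:]"
    unfolding row_k0[of 2 1] by (simp add: z)
  have high: "C i j 1 l = 0" "C i j 0 l = 0" if "i \<ge> 3" for i j l
    using that C_zero_if_ge_4[of i 1] C_zero_if_ge_4[of i 0] cubic_coeffs[of 3 0 j l] by (cases "i = 3"; simp)+
  have "row 1 1 0 = - row 0 1 0 - row 2 1 0 - smult a0 (row 1 2 0 + smult 2 (row 2 2 0))"
  proof (intro poly_eqI)
    fix l
    have "C 0 1 0 l + C 1 1 0 l + C 2 1 0 l = - a0 * (C 1 2 0 l + 2 * C 2 2 0 l)"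
      using coeffs_xy(5)[of 0 l] by (simp add: sum_upto_6 high)
    then have "C 1 1 0 l = - C 0 1 0 l - C 2 1 0 l - a0 * (C 1 2 0 l + 2 * C 2 2 0 l)"
      by algebra
    then show "coeff (row 1 1 0) l
      = coeff (- row 0 1 0 - row 2 1 0 - smult a0 (row 1 2 0 + smult 2 (row 2 2 0))) l"
      by simp
  qed
  then show "row 1 1 0 = [:- (a0 + a1) * C 2 2 0 0 - C 2 1 0 0, a3 * C 2 0 1 0:]"
    unfolding R0 R2 rows_y2 by (simp add: algebra_simps)
  have "row 1 1 1 = - row 2 1 1"
  proof (intro poly_eqI)
    fix l
    have "C 1 1 1 l + C 2 1 1 l = 0"
      using coeffs_xy(5)[of 1 l] c0[of 1 l] by (simp add: sum_upto_6 high z)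
    then show "coeff (row 1 1 1) l = coeff (- row 2 1 1) l"
      by (simp add: eq_neg_iff_add_eq_0)
  qed
  then show "row 1 1 1 = [:t * C 2 0 1 0, 0, - C 2 0 1 0:]"
    unfolding cubic_coeffs_1(2) by simp
qed

lemma rows_y0:
  "row 1 0 0 = [:C 1 0 0 0, - a3 * C 1 0 1 2:]"
  "row 1 0 1 = [:C 1 0 1 0, C 1 0 1 1, C 1 0 1 2:]"
  "row 2 0 0 = [:C 2 0 0 0:]"
proof -
  note [simp del] = One_nat_def
  have z: "C 1 0 2 l = 0" "C 2 0 2 l = 0" for l
    using C_zero_if_ge_4[of 2 2] cubic_coeffs[of 1 2] by simp_all
  have "C 2 0 1 2 = coeff (row 2 0 1) 2" by simp
  also have "\<dots> = 0" unfolding cubic_coeffs_1(3) by (simp add: numeral_2_eq_2)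
  finally show "row 2 0 0 = [:C 2 0 0 0:]"
    unfolding row_k0[of 2 0] by (simp add: z)
  show "row 1 0 0 = [:C 1 0 0 0, - a3 * C 1 0 1 2:]"
    unfolding row_k0[of 1 0] by (simp add: z)
  show "row 1 0 1 = [:C 1 0 1 0, C 1 0 1 1, C 1 0 1 2:]"
    unfolding row_k1[of 1 0] by (simp add: z)
qed

lemma rows_high:
  "i \<ge> 3 \<Longrightarrow> row i j k = 0" "k \<ge> 3 \<Longrightarrow> row i j k = 0" "row 2 j 2 = 0" "row 1 j 2 = 0"
proof -
  show "row 2 j 2 = 0" "row 1 j 2 = 0"
    using C_zero_if_ge_4[of 2 2] cubic_coeffs[of 1 2] by (simp_all add: row_eq_0_iff)
  show "i \<ge> 3 \<Longrightarrow> row i j k = 0"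
    using C_zero_if_ge_4[of i k] cubic_coeffs[of i k] by (cases "i = 3 \<and> k = 0") (auto simp: row_eq_0_iff)
  show "k \<ge> 3 \<Longrightarrow> row i j k = 0"
    using C_zero_if_ge_4[of i k] cubic_coeffs[of i k] by (cases "k = 3 \<and> i = 0") (auto simp: row_eq_0_iff)
qed

text \<open>
  The polynomials of degree at most 6 that are regular in \<open>r0\<close>, \<open>r1\<close> and \<open>r3\<close> and satisfy the leading order
  conditions of \<open>r2\<close> for \<open>N \<ge> 3\<close>. The combination \<open>x y^2 - a1 y\<close> equals \<open>- X\<close>.
\<close>

lemma K_explicit:
  "ev4 K x y z w =
     C 2 2 0 0 * (x ^ 2 * y ^ 2 - (x * y ^ 2 - a1 * y) - (a0 + a1) * (x * y))
   + C 2 1 0 0 * (x ^ 2 * y - x * y)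
   + C 2 0 1 0 * (x ^ 2 * z - (t - w ^ 2) * (x ^ 2 * y - x * y) * z - a3 * w * (x ^ 2 * y - x * y))
   + C 2 0 0 0 * x ^ 2
   + x * z * (C 1 0 1 0 + C 1 0 1 1 * w + C 1 0 1 2 * w ^ 2) + x * (C 1 0 0 0 - a3 * C 1 0 1 2 * w)
   + z ^ 2 * poly (row 0 0 2) w + z * poly (row 0 0 1) w + poly (row 0 0 0) w"
proof -
  note [simp del] = One_nat_def
  have "ev4 K x y z w = (\<Sum>k\<le>2. \<Sum>j\<le>2. \<Sum>i\<le>2. poly (row i j k) w * x ^ i * y ^ j * z ^ k)"
  proof -
    have "(\<Sum>i\<le>6. poly (row i j k) w * x ^ i * y ^ j * z ^ k)
        = (\<Sum>i\<le>2. poly (row i j k) w * x ^ i * y ^ j * z ^ k)" for j k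
      by (intro sum.mono_neutral_right) (auto simp: rows_high(1))
    moreover have "(\<Sum>k\<le>6. \<Sum>j\<le>2. \<Sum>i\<le>2. poly (row i j k) w * x ^ i * y ^ j * z ^ k)
        = (\<Sum>k\<le>2. \<Sum>j\<le>2. \<Sum>i\<le>2. poly (row i j k) w * x ^ i * y ^ j * z ^ k)"
      by (intro sum.mono_neutral_right) (auto simp: rows_high(2))
    ultimately show ?thesis unfolding K_rows by simp
  qed
  then show ?thesis
    by (simp add: sum_upto_2 rows_y2 rows_y1 rows_y0 rows_high(3,4) cubic_coeffs_1(2,3))
      (simp add: algebra_simps power2_eq_square)
qed

section \<open>The remaining constants\<close>

text \<open>
  The function \<open>v^2 (K + 1 / v)\<close> on the surface \<open>\<zeta> = 0\<close> of \<open>regular2_chart\<close>, as a polynomial in \<open>v\<close> (outer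
  variable) and \<open>s\<close>. Here \<open>U = c + s v\<close> is \<open>1 / y\<close> and \<open>E = c + (s - a1) v\<close> is \<open>- x y v\<close>.
\<close>

definition chart :: "Ct \<Rightarrow> Ct poly poly" where
  "chart w = (let c = t - w ^ 2; k = (\<lambda>b. [:[:b:]:]); V = [:0, 1:]; S = [:[:0, 1:]:];
      U = [:[:c:], [:0, 1:]:]; E = [:[:c:], [:- a1, 1:]:];
      \<epsilon> = C 1 0 1 0 + C 1 0 1 1 * w + C 1 0 1 2 * w ^ 2
    in k (C 2 2 0 0) * (E ^ 2 + V + k (a0 + a1) * E * V)
     + k (C 2 1 0 0) * (U * E ^ 2 + E * V)
     + k (C 2 0 1 0) * (k (2 * w) * U * E ^ 2 * S - k (2 * c * w) * E - k (a3 * w) * (U * E ^ 2 + E * V))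
     + k (C 2 0 0 0) * (U * E) ^ 2
     - k (2 * w * \<epsilon>) * U * E - k (C 1 0 0 0 - a3 * C 1 0 1 2 * w) * U * E * V
     + k (4 * w ^ 2 * poly (row 0 0 2) w) + k (2 * w * poly (row 0 0 1) w) * V
     + k (poly (row 0 0 0) w) * V ^ 2 + V)"

lemma poly_chart:
  assumes v: "v \<noteq> 0" and u: "t - w ^ 2 + s * v \<noteq> 0"
  shows "poly (poly (chart w) [:v:]) s = v ^ 2 * ev4 Q2 v ((- a2 - s) / v) 0 w"
proof -
  define c where "c = t - w ^ 2"
  define u where "u = c + s * v"
  define E where "E = c + (s - a1) * v"
  define \<epsilon> where "\<epsilon> = C 1 0 1 0 + C 1 0 1 1 * w + C 1 0 1 2 * w ^ 2"
  define f where "f = C 1 0 0 0 - a3 * C 1 0 1 2 * w"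
  have "u \<noteq> 0" using u by (simp add: u_def c_def)
  define x where "x = - u * E / v"
  define y where "y = 1 / u"
  define z where "z = 2 * w / v"
  have xy: "x * y = - E / v" and x2y: "x ^ 2 * y = u * E ^ 2 / v ^ 2" and x2: "x ^ 2 = (u * E) ^ 2 / v ^ 2"
    and x2y2: "x ^ 2 * y ^ 2 = E ^ 2 / v ^ 2"
    using \<open>u \<noteq> 0\<close> by (simp_all add: x_def y_def power2_eq_square)
  have xy2: "x * y ^ 2 - a1 * y = - 1 / v"
  proof -
    have "x * y ^ 2 - a1 * y = (x * y - a1) * y"
      by (simp add: power2_eq_square algebra_simps)
    also have "\<dots> = (- E / v - a1) / u"
      unfolding xy by (simp add: y_def)
    also have "- E / v - a1 = - u / v"
      using v by (simp add: E_def u_def field_simps)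
    finally show ?thesis using \<open>u \<noteq> 0\<close> by simp
  qed
  have cubic: "v ^ 2 * (x ^ 2 * z - c * (x ^ 2 * y - x * y) * z - a3 * w * (x ^ 2 * y - x * y))
    = 2 * w * u * E ^ 2 * s - 2 * c * w * E - a3 * w * (u * E ^ 2 + E * v)"
  proof -
    have "v ^ 2 * (x ^ 2 * z - c * (x ^ 2 * y - x * y) * z - a3 * w * (x ^ 2 * y - x * y))
      = (2 * w * u * E ^ 2 * (u - c)) / v - 2 * c * w * E - a3 * w * (u * E ^ 2 + E * v)"
      unfolding x2y xy unfolding x2 z_def using v by (simp add: field_simps power2_eq_square)
    also have "u - c = s * v" by (simp add: u_def)
    finally show ?thesis using v by simp
  qed
  have "ev4 Q2 v ((- a2 - s) / v) 0 w = ev4 K x y z w + 1 / v"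
    using regular2_chart[OF v u[unfolded u_def], where \<zeta> = 0]
    by (simp add: x_def y_def z_def u_def E_def c_def)
  then have "v ^ 2 * ev4 Q2 v ((- a2 - s) / v) 0 w =
      C 2 2 0 0 * (v ^ 2 * (x ^ 2 * y ^ 2 - (x * y ^ 2 - a1 * y) - (a0 + a1) * (x * y)))
    + C 2 1 0 0 * (v ^ 2 * (x ^ 2 * y - x * y))
    + C 2 0 1 0 * (v ^ 2 * (x ^ 2 * z - c * (x ^ 2 * y - x * y) * z - a3 * w * (x ^ 2 * y - x * y)))
    + C 2 0 0 0 * (v ^ 2 * x ^ 2)
    + (v ^ 2 * (x * z)) * \<epsilon> + (v ^ 2 * x) * f
    + (v ^ 2 * z ^ 2) * poly (row 0 0 2) w + (v ^ 2 * z) * poly (row 0 0 1) w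
    + v ^ 2 * poly (row 0 0 0) w + v ^ 2 * (1 / v)"
    unfolding K_explicit \<epsilon>_def f_def c_def by (simp only: distrib_left mult_ac)
  also have "v ^ 2 * (x ^ 2 * y ^ 2 - (x * y ^ 2 - a1 * y) - (a0 + a1) * (x * y)) = E ^ 2 + v + (a0 + a1) * E * v"
    unfolding xy2 x2y2 xy using v by (simp add: field_simps power2_eq_square)
  also note cubic
  also have "v ^ 2 * (x ^ 2 * y - x * y) = u * E ^ 2 + E * v"
    unfolding x2y xy using v by (simp add: field_simps power2_eq_square)
  also have "v ^ 2 * x ^ 2 = (u * E) ^ 2" unfolding x2 using v by simp
  also have "v ^ 2 * (x * z) = - 2 * w * u * E" using v by (simp add: x_def z_def power2_eq_square)
  also have "v ^ 2 * x = - u * E * v" using v by (simp add: x_def power2_eq_square)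
  also have "v ^ 2 * z ^ 2 = 4 * w ^ 2" using v by (simp add: z_def power2_eq_square)
  also have "v ^ 2 * z = 2 * w * v" using v by (simp add: z_def power2_eq_square)
  also have "v ^ 2 * (1 / v) = v" using v by (simp add: power2_eq_square)
  finally show ?thesis
    by (simp add: chart_def Let_def u_def E_def \<epsilon>_def f_def c_def power2_eq_square algebra_simps)
qed

lemma chart_dvd:
  assumes w: "t - w ^ 2 \<noteq> 0" and n: "n < 2"
  shows "[:a2, 1:] ^ (2 - n) dvd coeff (chart w) n"
proof -
  have "[:- (- a2), 1:] ^ (2 - n) dvd coeff (chart w) n"
  proof (rule blowup_dvd[OF _ _ n])
    show "polyfun2 (\<lambda>Y v. ev4 Q2 v Y 0 w)"
      by (intro polyfun2_intros polyfun2_ev4)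
    fix Y
    have "finite {v. poly [:t - w ^ 2, - a2, - Y:] v = 0}"
      by (rule poly_roots_finite) (use w in simp)
    then have fin: "finite ({0} \<union> {v. poly [:t - w ^ 2, - a2, - Y:] v = 0})" by simp
    show "finite {v. poly (poly (chart w) [:v:]) (- a2 - Y * v) \<noteq> v ^ 2 * ev4 Q2 v Y 0 w}"
    proof (rule finite_subset[OF _ fin], intro subsetI, rule ccontr)
      fix v
      assume v: "v \<in> {v. poly (poly (chart w) [:v:]) (- a2 - Y * v) \<noteq> v ^ 2 * ev4 Q2 v Y 0 w}"
        and "v \<notin> {0} \<union> {v. poly [:t - w ^ 2, - a2, - Y:] v = 0}"
      then have "v \<noteq> 0" "t - w ^ 2 + (- a2 - Y * v) * v \<noteq> 0"
        by (auto simp: algebra_simps)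
      from poly_chart[OF this] v \<open>v \<noteq> 0\<close> show False by simp
    qed
  qed
  then show ?thesis by simp
qed

text \<open>
  The coefficient of \<open>v^0\<close> in \<open>chart w\<close> has degree at most 1 in \<open>s\<close> and is divisible by \<open>(s + a2)^2\<close>, hence zero.
  Its part linear in \<open>s\<close> comes from the cubic term alone and is \<open>2 w c^3\<close> times the coefficient
  in question.
\<close>

lemma cubic_coeff_zero: "C 2 0 1 0 = 0"
proof -
  obtain w where w: "w \<notin> {w. t - w ^ 2 = 0} \<union> {0}"
    using ex_new_if_finite[OF infinite_UNIV_char_0] finite_cp_roots by (metis finite.emptyI finite.insertI finite_Un)
  define c where "c = t - w ^ 2"
  have "c \<noteq> 0" "w \<noteq> 0" using w by (auto simp: c_def)
  define A where "A = poly (coeff (chart w) 0) 0"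
  have "poly (coeff (chart w) 0) s = A + 2 * w * c ^ 3 * C 2 0 1 0 * s" for s
    by (simp add: A_def chart_def Let_def c_def flip: poly_0_coeff_0)
      (simp add: algebra_simps power2_eq_square power3_eq_cube)
  then have eq: "coeff (chart w) 0 = [:A, 2 * w * c ^ 3 * C 2 0 1 0:]"
    by (intro poly_eqI_cofinite) (simp add: mult_ac)
  have "[:a2, 1:] ^ 2 dvd coeff (chart w) 0"
    using chart_dvd[of w 0] \<open>c \<noteq> 0\<close> by (simp add: c_def)
  moreover have "degree (coeff (chart w) 0) \<le> 1"
    unfolding eq by (rule order_trans[OF degree_pCons_le]) simp
  ultimately have "coeff (chart w) 0 = 0"
    using dvd_imp_degree_le[of "[:a2, 1:] ^ 2" "coeff (chart w) 0"]
    by (fastforce simp: degree_linear_power)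
  then show ?thesis
    using \<open>c \<noteq> 0\<close> \<open>w \<noteq> 0\<close> by (simp add: eq)
qed

text \<open>
  With the cubic terms gone, \<open>lead_coeffs\<close> applies with \<open>N = 2\<close>. The coefficient of \<open>x z\<close> gives
  \<open>c^2 (e0 + e1 w + e2 w^2) = 4 w h(w)\<close> for the coefficient \<open>h\<close> of \<open>z^2\<close>; therefore \<open>h = \<eta> c^2\<close> and \<open>x z\<close> has the
  coefficient \<open>4 \<eta> w\<close>. The coefficient of \<open>x^2\<close> at \<open>y = 1/c\<close> then has to be
  \<open>4 \<eta> w^2 / c^2 = 4 \<eta> (t - c) / c^2\<close>, which can be read as a polynomial in \<open>1/c\<close>.
\<close>

lemma quadratic_coeffs:
  "C 2 0 0 0 = 0" "C 2 1 0 0 = - 4 * C 0 0 2 4" "C 2 2 0 0 = 4 * t * C 0 0 2 4"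
  "C 1 0 1 0 = 0" "C 1 0 1 1 = 4 * C 0 0 2 4" "C 1 0 1 2 = 0"
  "C 0 0 2 0 = t ^ 2 * C 0 0 2 4" "C 0 0 2 1 = 0" "C 0 0 2 2 = - 2 * t * C 0 0 2 4" "C 0 0 2 3 = 0"
proof -
  note [simp del] = One_nat_def
  have zero: "C i j k l = 0" if "i + k > 2" for i j k l
  proof -
    have "i + k \<ge> 4 \<or> i + k = 3 \<and> k \<noteq> 1 \<or> i = 2 \<and> k = 1" using that by arith
    then consider "i + k \<ge> 4" | "i + k = 3" "k \<noteq> 1" | "i = 2" "k = 1" by blast
    then show ?thesis
    proof cases
      case 3
      have "row 2 j 1 = 0"
      proof -
        consider "j = 0" | "j = 1" | "j = 2" | "j \<ge> 3" by linarith
        then show ?thesis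
          by cases (simp_all add: cubic_coeffs_1 cubic_coeff_zero rows_y2 coeffs_xy(1) row_eq_0_iff)
      qed
      then show ?thesis using 3 by (simp add: row_eq_0_iff)
    qed (use C_zero_if_ge_4 cubic_coeffs in auto)
  qed
  have lead: "lead 1 1 = cp ^ 2 * row 1 0 1" "lead 0 2 = cp ^ 2 * row 0 0 2"
    "lead 2 0 = [:C 2 2 0 0:] + cp * [:C 2 1 0 0:] + cp ^ 2 * [:C 2 0 0 0:]"
    by (simp_all add: lead_def rows_y2 rows_y1 rows_y0 cubic_coeff_zero)
  have "lead 1 1 * cp ^ 2 = smult 4 (lead 0 2 * [:0, 1:])"
    using lead_coeffs[of 2 1] zero by (simp add: One_nat_def)
  then have "cp ^ 2 * (cp ^ 2 * row 1 0 1) = cp ^ 2 * smult 4 (row 0 0 2 * [:0, 1:])"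
    unfolding lead by (simp only: mult_smult_left mult_smult_right mult_ac)
  then have E: "cp ^ 2 * row 1 0 1 = smult 4 (row 0 0 2 * [:0, 1:])"
    by (subst (asm) mult_cancel_left) simp
  have L: "cp ^ 2 * row 1 0 1 = [:t ^ 2 * C 1 0 1 0, t ^ 2 * C 1 0 1 1, t ^ 2 * C 1 0 1 2 - 2 * t * C 1 0 1 0,
      - 2 * t * C 1 0 1 1, C 1 0 1 0 - 2 * t * C 1 0 1 2, C 1 0 1 1, C 1 0 1 2:]"
    by (simp add: cp_def rows_y0 power2_eq_square algebra_simps)
  have R: "smult 4 (row 0 0 2 * [:0, 1:])
      = [:0, 4 * C 0 0 2 0, 4 * C 0 0 2 1, 4 * C 0 0 2 2, 4 * C 0 0 2 3, 4 * C 0 0 2 4, 0:]"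
    by (simp add: row_002)
  have "[:t ^ 2 * C 1 0 1 0, t ^ 2 * C 1 0 1 1, t ^ 2 * C 1 0 1 2 - 2 * t * C 1 0 1 0,
      - 2 * t * C 1 0 1 1, C 1 0 1 0 - 2 * t * C 1 0 1 2, C 1 0 1 1, C 1 0 1 2:]
      = [:0, 4 * C 0 0 2 0, 4 * C 0 0 2 1, 4 * C 0 0 2 2, 4 * C 0 0 2 3, 4 * C 0 0 2 4, 0:]"
    by (rule trans[OF trans[OF L[symmetric] E] R])
  then have eqs: "t ^ 2 * C 1 0 1 0 = 0" "t ^ 2 * C 1 0 1 1 = 4 * C 0 0 2 0"
    "t ^ 2 * C 1 0 1 2 - 2 * t * C 1 0 1 0 = 4 * C 0 0 2 1" "- 2 * t * C 1 0 1 1 = 4 * C 0 0 2 2"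
    "C 1 0 1 0 - 2 * t * C 1 0 1 2 = 4 * C 0 0 2 3" "C 1 0 1 1 = 4 * C 0 0 2 4" "C 1 0 1 2 = 0"
    unfolding pCons_eq_iff by blast+
  have e0: "C 1 0 1 0 = 0" using eqs(1) t_nonzero by simp
  have 1: "C 1 0 1 0 = 0" "C 1 0 1 2 = 0" "4 * C 0 0 2 4 = C 1 0 1 1" "4 * C 0 0 2 0 = t ^ 2 * C 1 0 1 1"
    "C 0 0 2 1 = 0" "4 * C 0 0 2 2 = - 2 * t * C 1 0 1 1" "C 0 0 2 3 = 0"
    using eqs e0 by simp_all
  show "C 1 0 1 0 = 0" "C 1 0 1 1 = 4 * C 0 0 2 4" "C 1 0 1 2 = 0"
    "C 0 0 2 1 = 0" "C 0 0 2 3 = 0"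
    using 1 by simp_all
  have "4 * (C 0 0 2 0 - t ^ 2 * C 0 0 2 4) = 0"
  proof -
    have "4 * (C 0 0 2 0 - t ^ 2 * C 0 0 2 4) = 4 * C 0 0 2 0 - t ^ 2 * (4 * C 0 0 2 4)"
      by (simp add: right_diff_distrib mult.left_commute)
    then show ?thesis unfolding 1(3,4) by simp
  qed
  moreover have "4 * (C 0 0 2 2 + 2 * t * C 0 0 2 4) = 0"
  proof -
    have "4 * (C 0 0 2 2 + 2 * t * C 0 0 2 4) = 4 * C 0 0 2 2 + 2 * t * (4 * C 0 0 2 4)"
      by (simp add: distrib_left mult.left_commute)
    then show ?thesis unfolding 1(3,6) by simp
  qed
  ultimately have "C 0 0 2 0 - t ^ 2 * C 0 0 2 4 = 0" "C 0 0 2 2 + 2 * t * C 0 0 2 4 = 0"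
    unfolding mult_eq_0_iff[of 4] by simp_all
  then show h: "C 0 0 2 0 = t ^ 2 * C 0 0 2 4" "C 0 0 2 2 = - 2 * t * C 0 0 2 4"
    by (simp_all add: eq_neg_iff_add_eq_0)
  have r: "row 0 0 2 = smult (C 0 0 2 4) (cp ^ 2)"
    unfolding row_002 h 1 by (simp add: cp_def power2_eq_square algebra_simps)
  have cp4: "cp ^ 4 = cp ^ 2 * cp ^ 2" by (simp flip: power_add)
  have "lead 2 0 * cp ^ 4 = smult 4 (lead 0 2 * [:0, 1:] ^ 2)"
    using lead_coeffs[of 2 0] zero by simp
  then have "cp ^ 4 * lead 2 0 = cp ^ 4 * smult (4 * C 0 0 2 4) ([:0, 1:] ^ 2)"
    unfolding lead(2) r cp4 by (simp only: mult_smult_left mult_smult_right smult_smult mult_ac)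
  then have E: "lead 2 0 = smult (4 * C 0 0 2 4) ([:0, 1:] ^ 2)"
    by (subst (asm) mult_cancel_left) simp
  have L: "lead 2 0 = [:C 2 2 0 0 + t * C 2 1 0 0 + t ^ 2 * C 2 0 0 0, 0,
      - C 2 1 0 0 - 2 * t * C 2 0 0 0, 0, C 2 0 0 0:]"
    unfolding lead by (simp add: cp_def power2_eq_square algebra_simps)
  have R: "smult (4 * C 0 0 2 4) ([:0, 1:] ^ 2) = [:0, 0, 4 * C 0 0 2 4, 0, 0:]"
    by (simp add: power2_eq_square)
  have "[:C 2 2 0 0 + t * C 2 1 0 0 + t ^ 2 * C 2 0 0 0, 0,
      - C 2 1 0 0 - 2 * t * C 2 0 0 0, 0, C 2 0 0 0:] = [:0, 0, 4 * C 0 0 2 4, 0, 0:]"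
    by (rule trans[OF trans[OF L[symmetric] E] R])
  then have eqs: "C 2 2 0 0 + t * C 2 1 0 0 + t ^ 2 * C 2 0 0 0 = 0"
    "- C 2 1 0 0 - 2 * t * C 2 0 0 0 = 4 * C 0 0 2 4" "C 2 0 0 0 = 0"
    unfolding pCons_eq_iff by blast+
  show "C 2 0 0 0 = 0" by fact
  show b: "C 2 1 0 0 = - 4 * C 0 0 2 4"
    using eqs(2) by (simp add: eqs(3) minus_equation_iff[of "C 2 1 0 0"])
  show "C 2 2 0 0 = 4 * t * C 0 0 2 4"
    using eqs(1) by (simp add: b eqs(3))
qed

lemma chart_coeff_1:
  assumes "C 2 0 0 0 = 0"
  shows "poly (coeff (chart w) 1) s =
    C 2 2 0 0 * (2 * (t - w ^ 2) * (s - a1) + 1 + (a0 + a1) * (t - w ^ 2))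
    + C 2 1 0 0 * ((t - w ^ 2) ^ 2 * s + 2 * (t - w ^ 2) ^ 2 * (s - a1) + (t - w ^ 2))
    - 2 * w * (C 1 0 1 0 + C 1 0 1 1 * w + C 1 0 1 2 * w ^ 2) * (t - w ^ 2) * (2 * s - a1)
    - (C 1 0 0 0 - a3 * C 1 0 1 2 * w) * (t - w ^ 2) ^ 2 + 2 * w * poly (row 0 0 1) w + 1"
  unfolding chart_def Let_def assms cubic_coeff_zero
  by (simp add: power2_eq_square) (simp add: algebra_simps power2_eq_square)

text \<open>
  The coefficient of \<open>v\<close> in \<open>chart w\<close> vanishes at \<open>s = - a2\<close>. This is a polynomial of degree 4 in \<open>w\<close>
  whose five coefficients are \<open>p0\<close>, \<open>2 C 0 0 1 0\<close>, \<open>p2\<close>, \<open>2 C 0 0 1 2\<close> and \<open>p4\<close>; from \<open>p4\<close> one finds the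
  coefficient \<open>f\<close> of \<open>x\<close>, then from \<open>p0\<close> the constant \<open>\<eta>\<close>, then from \<open>p2\<close> the coefficient of
  \<open>z w\<close>. The parameter relation enters through \<open>p0\<close>.
\<close>

lemma linear_coeffs:
  "4 * t ^ 2 * C 0 0 2 4 = - 1" "C 1 0 0 0 = - 4 * C 0 0 2 4 * (a2 + a3)"
  "C 0 0 1 0 = 0" "C 0 0 1 2 = 0"
  "C 0 0 1 1 = - 2 * C 0 0 2 4 * (1 - t * (a0 + a1 + 2 * a2 + 2 * a3))"
proof -
  note [simp del] = One_nat_def
  define \<eta> where "\<eta> = C 0 0 2 4"
  define f where "f = C 1 0 0 0"
  note quad = quadratic_coeffs[folded \<eta>_def]
  define p0 where "p0 = 4 * t * \<eta> * (1 + (a0 + a1) * t - 2 * t * (a1 + a2)) - 4 * \<eta> * (t - t ^ 2 * (2 * a1 + 3 * a2)) - t ^ 2 * f + 1"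
  define p2 where "p2 = 4 * t * \<eta> * (2 * (a1 + a2) - (a0 + a1)) - 4 * \<eta> * (2 * t * (2 * a1 + 3 * a2) - 1)
    + 8 * \<eta> * t * (a1 + 2 * a2) + 2 * t * f + 2 * C 0 0 1 1"
  define p4 where "p4 = 4 * \<eta> * (2 * a1 + 3 * a2) - 8 * \<eta> * (a1 + 2 * a2) - f - 4 * a3 * \<eta>"
  have "poly [:p0, 2 * C 0 0 1 0, p2, 2 * C 0 0 1 2, p4:] w = 0" if w: "t - w ^ 2 \<noteq> 0" for w
  proof -
    have "[:a2, 1:] dvd coeff (chart w) 1"
      using chart_dvd[OF w, of 1] by simp
    then have "0 = poly (coeff (chart w) 1) (- a2)"
      using poly_eq_0_iff_dvd[of _ "- a2"] by simp
    also have "\<dots> = poly [:p0, 2 * C 0 0 1 0, p2, 2 * C 0 0 1 2, p4:] w"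
      unfolding chart_coeff_1[OF quad(1)] quad f_def[symmetric] row_k1 \<eta>_def[symmetric]
      by (simp add: p0_def p2_def p4_def algebra_simps power2_eq_square)
    finally show ?thesis ..
  qed
  then have "[:p0, 2 * C 0 0 1 0, p2, 2 * C 0 0 1 2, p4:] = 0"
    by (intro poly_eqI_cofinite finite_subset[OF _ finite_cp_roots]) auto
  then have p: "p0 = 0" "C 0 0 1 0 = 0" "p2 = 0" "C 0 0 1 2 = 0" "p4 = 0" by simp_all
  show "C 0 0 1 0 = 0" "C 0 0 1 2 = 0" by fact+
  have f: "f = - 4 * \<eta> * (a2 + a3)"
    using p(5) unfolding p4_def by algebra
  then show "C 1 0 0 0 = - 4 * C 0 0 2 4 * (a2 + a3)" by (simp add: f_def \<eta>_def)
  have "p0 = 4 * t ^ 2 * \<eta> * (a0 + a1 + 2 * a2 + a3) + 1"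
    unfolding p0_def f by algebra
  then show "4 * t ^ 2 * C 0 0 2 4 = - 1"
    using p(1) by (simp add: parameters \<eta>_def eq_neg_iff_add_eq_0)
  have "p2 = 2 * (C 0 0 1 1 + 2 * \<eta> * (1 - t * (a0 + a1 + 2 * a2 + 2 * a3)))"
    unfolding p2_def f by algebra
  with p(3) have "2 * (C 0 0 1 1 + 2 * \<eta> * (1 - t * (a0 + a1 + 2 * a2 + 2 * a3))) = 0" by simp
  then have "C 0 0 1 1 + 2 * \<eta> * (1 - t * (a0 + a1 + 2 * a2 + 2 * a3)) = 0"
    unfolding mult_eq_0_iff[of 2] by simp
  then show "C 0 0 1 1 = - 2 * C 0 0 2 4 * (1 - t * (a0 + a1 + 2 * a2 + 2 * a3))"
    by (simp add: \<eta>_def eq_neg_iff_add_eq_0)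
qed

lemma K_formula:
  "t ^ 2 * (ev4 K x y z w - C 0 0 0 0) =
    - t * x * (x - 1) * y ^ 2 + (x ^ 2 + ((a0 + a1) * t - 1) * x - a1 * t) * y + (a2 + a3) * x
    - z ^ 2 * w ^ 4 / 4 + a3 / 2 * z * w ^ 3 + (2 * t * z ^ 2 - a3 ^ 2) * w ^ 2 / 4
    - ((a0 + a1 + 2 * a2 + 2 * a3) * t - 1) * z * w / 2 - t ^ 2 * z ^ 2 / 4 - x * z * w"
proof -
  define \<eta> where "\<eta> = C 0 0 2 4"
  note coeffs = cubic_coeff_zero quadratic_coeffs[folded \<eta>_def] linear_coeffs[folded \<eta>_def]
  have r: "row 0 0 2 = [:t ^ 2 * \<eta>, 0, - 2 * t * \<eta>, 0, \<eta>:]"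
    "row 0 0 1 = [:0, - 2 * \<eta> * (1 - t * (a0 + a1 + 2 * a2 + 2 * a3)), 0, - 2 * a3 * \<eta>:]"
    "row 0 0 0 = [:C 0 0 0 0, 0, a3 ^ 2 * \<eta>:]"
    unfolding row_002 row_k1 row_k0 coeffs \<eta>_def[symmetric] by simp_all
  have "ev4 K x y z w - C 0 0 0 0 = \<eta> * (
      4 * t * (x ^ 2 * y ^ 2 - (x * y ^ 2 - a1 * y) - (a0 + a1) * (x * y))
      - 4 * (x ^ 2 * y - x * y) + 4 * x * z * w - 4 * (a2 + a3) * x
      + z ^ 2 * (t - w ^ 2) ^ 2
      + z * (- 2 * (1 - t * (a0 + a1 + 2 * a2 + 2 * a3)) * w - 2 * a3 * w ^ 3) + a3 ^ 2 * w ^ 2)"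
    unfolding K_explicit r unfolding coeffs
    by (simp add: algebra_simps power2_eq_square power3_eq_cube)
  moreover have "t ^ 2 * \<eta> = - 1 / 4"
    using linear_coeffs(1) by (simp add: \<eta>_def field_simps)
  ultimately have "t ^ 2 * (ev4 K x y z w - C 0 0 0 0) = - 1 / 4 * (
      4 * t * (x ^ 2 * y ^ 2 - (x * y ^ 2 - a1 * y) - (a0 + a1) * (x * y))
      - 4 * (x ^ 2 * y - x * y) + 4 * x * z * w - 4 * (a2 + a3) * x
      + z ^ 2 * (t - w ^ 2) ^ 2
      + z * (- 2 * (1 - t * (a0 + a1 + 2 * a2 + 2 * a3)) * w - 2 * a3 * w ^ 3) + a3 ^ 2 * w ^ 2)"
    by (simp only: mult.assoc[symmetric])
  also have "\<dots> = - t * x * (x - 1) * y ^ 2 + (x ^ 2 + ((a0 + a1) * t - 1) * x - a1 * t) * y + (a2 + a3) * x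
    - z ^ 2 * w ^ 4 / 4 + a3 / 2 * z * w ^ 3 + (2 * t * z ^ 2 - a3 ^ 2) * w ^ 2 / 4
    - ((a0 + a1 + 2 * a2 + 2 * a3) * t - 1) * z * w / 2 - t ^ 2 * z ^ 2 / 4 - x * z * w"
    by (simp add: field_simps) (simp add: algebra_simps power2_eq_square power3_eq_cube power4_eq_xxxx)
  finally show ?thesis .
qed

end

section \<open>Polynomials, polynomial functions and Hamiltonian systems\<close>

text \<open>
  Used with \<open>\<iota>\<close> the embedding of \<open>F\<close> as constants into an iterated polynomial ring, where the variables are
  specialised one after the other.
\<close>

lemma poly_eq_0_if_zero_on_range:
  fixes p :: "'a::idom poly" and \<iota> :: "'b::field_char_0 \<Rightarrow> 'a"
  assumes "\<And>x. poly p (\<iota> x) = 0" "inj \<iota>"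
  shows "p = 0"
proof (rule ccontr)
  assume "p \<noteq> 0"
  then have "finite {x. poly p x = 0}" by (rule poly_roots_finite)
  then have "finite (range \<iota>)"
    by (rule rev_finite_subset) (use assms(1) in auto)
  then show False
    using assms(2) infinite_UNIV_char_0 by (metis finite_imageD)
qed

lemma ev4_inject:
  assumes "\<And>x y z w. ev4 P x y z w = ev4 Q x y z w"
  shows "P = Q"
proof -
  have "poly (poly (poly (poly (P - Q) [:[:[:w:]:]:]) [:[:z:]:]) [:y:]) x = 0" for x y z w
    using assms[of x y z w] ev4_hom(2)[of P Q x y z w] by (simp only: ev4_def) simp
  then have "poly (poly (poly (P - Q) [:[:[:w:]:]:]) [:[:z:]:]) [:y:] = 0" for y z w
    by (intro poly_eq_0_if_zero_on_range[of _ "\<lambda>x. x"]) (auto intro: injI)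
  then have "poly (poly (P - Q) [:[:[:w:]:]:]) [:[:z:]:] = 0" for z w
    by (rule poly_eq_0_if_zero_on_range) (auto intro: injI)
  then have "poly (P - Q) [:[:[:w:]:]:] = 0" for w
    by (rule poly_eq_0_if_zero_on_range) (auto intro: injI)
  then have "P - Q = 0"
    by (rule poly_eq_0_if_zero_on_range) (auto intro: injI)
  then show ?thesis by simp
qed

lemma map_poly_additive:
  assumes "\<And>p q. f (p + q) = f p + f q" "f 0 = 0"
  shows "map_poly f (p + q) = map_poly f p + map_poly f q"
  by (intro poly_eqI) (simp add: coeff_map_poly assms)

lemma hamiltonian_system_add_const: "hamiltonian_system (P + const4 d) = hamiltonian_system P"
proof -
  have "pd_x (P + const4 d) = pd_x P + pd_x (const4 d)" "pd_y (P + const4 d) = pd_y P + pd_y (const4 d)"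
    "pd_z (P + const4 d) = pd_z P + pd_z (const4 d)" "pd_w (P + const4 d) = pd_w P + pd_w (const4 d)"
    unfolding pd_x_def pd_y_def pd_z_def pd_w_def
    by (simp_all add: map_poly_additive pderiv_add)
  moreover have "pd_x (const4 d) = 0" "pd_y (const4 d) = 0" "pd_z (const4 d) = 0" "pd_w (const4 d) = 0"
    unfolding pd_x_def pd_y_def pd_z_def pd_w_def const4_def
    by (simp_all add: map_poly_pCons pderiv_pCons)
  ultimately show ?thesis by (simp add: hamiltonian_system_def)
qed

lemma coeff4_zero_if_total_degree_less:
  assumes "total_degree P < i + j + k + l"
  shows "coeff4 P i j k l = 0"
proof (rule ccontr)
  assume "coeff4 P i j k l \<noteq> 0"
  then have "i + j + k + l \<le> total_degree P"
    unfolding total_degree_def using finite_total_degree_set[of P] by (intro Max_ge) auto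
  then show False using assms by simp
qed

lemma cnum_add: "cnum (a + b) = cnum a + cnum b"
  unfolding cnum_def to_fract_add[symmetric] by simp

section \<open>Uniqueness of the Hamiltonian system\<close>

theorem theorem4p5:
  fixes \<alpha>0 \<alpha>1 \<alpha>2 \<alpha>3 :: complex and K :: mpoly4
  assumes "\<alpha>0 + \<alpha>1 + 2 * \<alpha>2 + \<alpha>3 = 1"
    and "total_degree K = 6"
    and "polynomial_in_coords (r0 \<alpha>0 coords_xyzw) (to_fract K)"
    and "polynomial_in_coords (r1 \<alpha>1 coords_xyzw) (to_fract K)"
    and "polynomial_in_coords (r3 \<alpha>3 coords_xyzw) (to_fract K)"
    and "polynomial_in_coords (r2 \<alpha>2 (r1 \<alpha>1 coords_xyzw))
           (to_fract K + fst (r1 \<alpha>1 coords_xyzw))"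
  shows "hamiltonian_system K = hamiltonian_system (ham_H \<alpha>0 \<alpha>1 \<alpha>2 \<alpha>3)"
proof -
  obtain Q0 where Q0: "\<And>x y z w. y \<noteq> 0 \<Longrightarrow> ev4 K x y z w = ev4 Q0 (- ((x - 1) * y - cnum \<alpha>0) * y) (1 / y) z w"
    by (rule regular_r0[OF assms(3)]) blast
  obtain Q1 where Q1: "\<And>x y z w. y \<noteq> 0 \<Longrightarrow> ev4 K x y z w = ev4 Q1 (- (x * y - cnum \<alpha>1) * y) (1 / y) z w"
    by (rule regular_r1[OF assms(4)]) blast
  obtain Q3 where Q3: "\<And>x y z w. w \<noteq> 0 \<Longrightarrow> ev4 K x y z w = ev4 Q3 x y (- (z * w - cnum \<alpha>3) * w) (1 / w)"
    by (rule regular_r3[OF assms(5)]) blast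
  obtain Q2 where Q2: "\<And>x y z w X. y \<noteq> 0 \<Longrightarrow> X = - (x * y - cnum \<alpha>1) * y \<Longrightarrow> X \<noteq> 0 \<Longrightarrow>
    ev4 K x y z w + X = ev4 Q2 (1 / X) (- ((1 / y + w^2 - tvar) * X + cnum \<alpha>2) * X) (z - 2 * X * w) w"
    by (rule regular_r2[OF assms(6)]) blast
  have "cnum \<alpha>0 + cnum \<alpha>1 + 2 * cnum \<alpha>2 + cnum \<alpha>3 = cnum (\<alpha>0 + \<alpha>1 + 2 * \<alpha>2 + \<alpha>3)"
    by (simp only: cnum_add mult_2 add.assoc)
  also have "\<dots> = 1"
    unfolding assms(1) by (simp add: cnum_def flip: one_pCons)
  finally have param: "cnum \<alpha>0 + cnum \<alpha>1 + 2 * cnum \<alpha>2 + cnum \<alpha>3 = 1" .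
  have t: "tvar \<noteq> 0" by (simp add: tvar_def)
  interpret regular_hamiltonian K "cnum \<alpha>0" "cnum \<alpha>1" "cnum \<alpha>2" "cnum \<alpha>3" tvar Q0 Q1 Q2 Q3
  proof
    show "coeff4 K i j k l = 0" if "i + j + k + l > 6" for i j k l
      using that assms(2) by (intro coeff4_zero_if_total_degree_less) simp
  qed (fact param t Q0 Q1 Q3 Q2)+
  \<comment> \<open>The constant term of \<open>K\<close> is free, while that of \<open>H\<close> is \<open>- (\<alpha>0 t - 1) \<alpha>1 / t^2\<close>.\<close>
  define d where "d = coeff4 K 0 0 0 0 + (cnum \<alpha>0 * tvar - 1) * cnum \<alpha>1 / tvar ^ 2"
  have "K = ham_H \<alpha>0 \<alpha>1 \<alpha>2 \<alpha>3 + const4 d"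
  proof (rule ev4_inject)
    fix x y z w
    have "tvar ^ 2 * (ev4 K x y z w - coeff4 K 0 0 0 0)
        = tvar ^ 2 * ev4 (ham_H \<alpha>0 \<alpha>1 \<alpha>2 \<alpha>3) x y z w + (cnum \<alpha>0 * tvar - 1) * cnum \<alpha>1"
      unfolding K_formula using t by (simp add: ham_H_def Let_def)
    then have "ev4 K x y z w - coeff4 K 0 0 0 0
        = ev4 (ham_H \<alpha>0 \<alpha>1 \<alpha>2 \<alpha>3) x y z w + (cnum \<alpha>0 * tvar - 1) * cnum \<alpha>1 / tvar ^ 2"
      using t by (simp add: field_simps)
    then show "ev4 K x y z w = ev4 (ham_H \<alpha>0 \<alpha>1 \<alpha>2 \<alpha>3 + const4 d) x y z w"
      by (simp add: d_def algebra_simps)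
  qed
  then show ?thesis
    by (simp add: hamiltonian_system_add_const)
qed

end
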